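(* Let $n=3$, let $v_\infty\in\mathbb{R}^{4,1}$ be non-zero, and suppose the surface $\Lambda$ has constant mean curvature $H_\infty$ in the space-form $S_{v_\infty}$. Then $\Lambda$ admits $$p_\infty(\lambda):=\lambda^{-1}\tfrac12v_\infty^\perp+v_\infty^T+\lambda\tfrac12v_\infty^\perp$$ as a $q_\infty$-conserved quantity.
   Context: $\mathbb{R}^{4,1}$ has metric $(\,,\,)$ of signature $(4,1)$, extended complex bilinearly to $\mathbb{C}^{5}$; $\mathcal{L}$ is the set of non-zero null vectors of $\mathbb{R}^{4,1}$; $M$ is an oriented surface; $d$ is the trivial flat connection on $M\times\mathbb{R}^{4,1}$ and its complexification. The theory is local: restriction to a suitable non-empty open subset of $M$ is always understood. $\wedge^{2}\mathbb{R}^{4,1}\cong o(\mathbb{R}^{4,1})$ by $(v_1\wedge v_2)(w)=(w,v_1)v_2-(w,v_2)v_1$; $[\mu\wedge\eta](X,Y)=[\mu_X,\eta_Y]-[\mu_Y,\eta_X]$; $d^\nabla$ is the exterior derivative on endomorphism-valued forms. A surface is a null line subbundle $\Lambda\subset M\times\mathbb{R}^{4,1}$ defining an immersion $M\to\mathbb{P}(\mathcal{L})\cong S^3$ (standing assumption: not contained in any $2$-sphere of $S^3$). $M$ carries the conformal structure of the metrics $g_\sigma(X,Y)=(d_X\sigma,d_Y\sigma)$, $\sigma\in\Gamma(\Lambda)$ never-zero; $(1,0)$/$(0,1)$-parts and $*$ (with $*\omega=-\omega\circ J$) refer to it. For a holomorphic chart $z$, $\Lambda^{(1)}=\langle\sigma,\sigma_z,\sigma_{\bar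 z}\rangle$ and the central sphere congruence is (complexified) $S=\langle\sigma,\sigma_z,\sigma_{\bar z},\sigma_{z\bar z}\rangle$. $\mathcal{D}:=\pi_S\circ d\circ\pi_S+\pi_{S^\perp}\circ d\circ\pi_{S^\perp}$, $\mathcal{N}:=d-\mathcal{D}$. For a real $q\in\Omega^1(\Lambda\wedge\Lambda^{(1)})$, $\Lambda$ is $q$-constrained Willmore if $d^{\mathcal{D}}q=0$ and $d^{\mathcal{D}}*\mathcal{N}=2[q\wedge*\mathcal{N}]$. Set $d^{\lambda,q}_S:=\mathcal{D}+\lambda^{-1}\mathcal{N}^{1,0}+\lambda\mathcal{N}^{0,1}+(\lambda^{-2}-1)q^{1,0}+(\lambda^2-1)q^{0,1}$. A $q$-conserved quantity of a $q$-constrained Willmore $\Lambda$ is a Laurent polynomial $p(\lambda)=\lambda^{-1}v+v_0+\lambda\overline v$ with $v_0\in\Gamma(S)$ real, $v\in\Gamma(S^\perp)$, $p(1)\ne0$ and $d^{\lambda,q}_Sp(\lambda)=0$ for all $\lambda\in\mathbb{C}\backslash\{0\}$. For non-zero $v_\infty\in\mathbb{R}^{4,1}$, $S_{v_\infty}=\{v\in\mathcal{L}:(v,v_\infty)=-1\}$ (a space-form of curvature $-(v_\infty,v_\infty)$), $\sigma_\infty:=-\sigma/(\sigma,v_\infty)$ is the surface defined by $\Lambda$ in $S_{v_\infty}$, and $v_\infty^T,v_\infty^\perp$ are the orthogonal projections of $v_\infty$ onto $S$ and $S^\perp$. The mean curvature of $\Lambda$ in $S_{v_\infty}$ is $H_\infty:=(v_\infty^\perp,v_\infty^\perp)^{1/2}$,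 and $\Lambda$ has constant mean curvature in $S_{v_\infty}$ if this is constant. $N$ is the real unit section of $S^\perp$ with $v_\infty^\perp=H_\infty N$ (defined up to sign if $H_\infty=0$). For $\Lambda$ of constant mean curvature, $\eta_\infty:=\frac12\sigma_\infty\wedge dN$ and $q_\infty:=H_\infty\eta_\infty$; $\Lambda$ is $q_\infty$-constrained Willmore. *)

theory Defs
  imports "HOL-Analysis.Analysis"
begin

section \<open>Smooth maps between normed spaces\<close>

definition ddir :: "('a::real_normed_vector \<Rightarrow> 'b::real_normed_vector) \<Rightarrow> 'a \<Rightarrow> 'a \<Rightarrow> 'b" where
  "ddir f X w = frechet_derivative f (at w) X"

text \<open>Only used for open \<open>U\<close>.\<close>

primrec Ck_on ::
  "nat \<Rightarrow> 'a set \<Rightarrow> ('a::real_normed_vector \<Rightarrow> 'b::real_normed_vector) \<Rightarrow> bool" where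
  "Ck_on 0 U f \<longleftrightarrow> continuous_on U f"
| "Ck_on (Suc k) U f \<longleftrightarrow> (\<forall>w\<in>U. f differentiable (at w)) \<and> (\<forall>X. Ck_on k U (ddir f X))"

definition smooth_on :: "'a set \<Rightarrow> ('a::real_normed_vector \<Rightarrow> 'b::real_normed_vector) \<Rightarrow> bool" where
  "smooth_on U f \<longleftrightarrow> (\<forall>k. Ck_on k U f)"


section \<open>The space of signature (4,1) and its complexification\<close>

text \<open>
  The timelike coordinate is the one with index \<open>0 :: 5\<close> (which is the same index as \<open>5 :: 5\<close>).
  Being polymorphic, \<open>mink\<close> is at once the metric of \<open>real ^ 5\<close> and its complex bilinear
  (not sesquilinear) extension to \<open>complex ^ 5\<close>.
\<close>

definition mink :: "'a::comm_ring_1 ^ 5 \<Rightarrow> 'a ^ 5 \<Rightarrow> 'a" where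
  "mink x y = (\<Sum>i\<in>UNIV - {0}. x $ i * y $ i) - x $ 0 * y $ 0"

definition cvec :: "real ^ 5 \<Rightarrow> complex ^ 5" where
  "cvec v = (\<chi> i. complex_of_real (v $ i))"

definition cnj_vec :: "complex ^ 5 \<Rightarrow> complex ^ 5" where
  "cnj_vec v = (\<chi> i. cnj (v $ i))"

definition orth :: "('a::comm_ring_1 ^ 5) set \<Rightarrow> ('a ^ 5) set" where
  "orth W = {v. \<forall>w\<in>W. mink v w = 0}"

text \<open>Orthogonal projection onto a subspace on which \<open>mink\<close> is nondegenerate.\<close>

definition proj :: "('a::comm_ring_1 ^ 5) set \<Rightarrow> 'a ^ 5 \<Rightarrow> 'a ^ 5" where
  "proj W v = (THE u. u \<in> W \<and> v - u \<in> orth W)"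

definition light_cone :: "(real ^ 5) set" where
  "light_cone = {v. v \<noteq> 0 \<and> mink v v = 0}"

definition space_form :: "real ^ 5 \<Rightarrow> (real ^ 5) set" where
  "space_form vinf = {v \<in> light_cone. mink v vinf = - 1}"

text \<open>The identification of bivectors with skew endomorphisms.\<close>

definition wedge :: "complex ^ 5 \<Rightarrow> complex ^ 5 \<Rightarrow> complex ^ 5 \<Rightarrow> complex ^ 5" where
  "wedge a b w = mink w a *s b - mink w b *s a"


section \<open>Oriented surfaces\<close>

text \<open>
  A chart is an open set together with a complex coordinate on it; the orientation of the surface
  is the one for which charts are orientation preserving.
\<close>

type_synonym 'm chart = "'m set \<times> ('m \<Rightarrow> complex)"

abbreviation dom_of :: "'m chart \<Rightarrow> 'm set" where
  "dom_of \<equiv> fst"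

abbreviation coord :: "'m chart \<Rightarrow> 'm \<Rightarrow> complex" where
  "coord \<equiv> snd"

definition param :: "'m chart \<Rightarrow> complex \<Rightarrow> 'm" where
  "param \<kappa> = inv_into (dom_of \<kappa>) (coord \<kappa>)"

definition is_chart :: "('m::topological_space) chart \<Rightarrow> bool" where
  "is_chart \<kappa> \<longleftrightarrow> open (dom_of \<kappa>) \<and> open (coord \<kappa> ` dom_of \<kappa>) \<and>
     homeomorphism (dom_of \<kappa>) (coord \<kappa> ` dom_of \<kappa>) (coord \<kappa>) (param \<kappa>)"

text \<open>\<open>Im (cnj (L 1) * L \<i>)\<close> is the determinant of a real linear map \<open>L\<close> of the plane.\<close>

definition oriented_transition :: "('m::topological_space) chart \<Rightarrow> 'm chart \<Rightarrow> bool" where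
  "oriented_transition \<kappa> \<kappa>' \<longleftrightarrow>
     (let U = coord \<kappa> ` (dom_of \<kappa> \<inter> dom_of \<kappa>'); \<tau> = coord \<kappa>' \<circ> param \<kappa>
      in smooth_on U \<tau> \<and> (\<forall>w\<in>U. Im (cnj (ddir \<tau> 1 w) * ddir \<tau> \<i> w) > 0))"

definition oriented_surface ::
  "('m::{t2_space, second_countable_topology}) set \<Rightarrow> 'm chart set \<Rightarrow> bool" where
  "oriented_surface M A \<longleftrightarrow> M \<noteq> {} \<and> M = (\<Union>\<kappa>\<in>A. dom_of \<kappa>) \<and> (\<forall>\<kappa>\<in>A. is_chart \<kappa>) \<and>
     (\<forall>\<kappa>\<in>A. \<forall>\<kappa>'\<in>A. oriented_transition \<kappa> \<kappa>')"

definition smooth_section ::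
  "'m chart set \<Rightarrow> 'm set \<Rightarrow> ('m \<Rightarrow> 'b::real_normed_vector) \<Rightarrow> bool" where
  "smooth_section A V f \<longleftrightarrow>
     (\<forall>\<kappa>\<in>A. smooth_on (coord \<kappa> ` (dom_of \<kappa> \<inter> V)) (f \<circ> param \<kappa>))"


section \<open>Surfaces in the conformal 3-sphere\<close>

text \<open>\<open>lift A \<Lambda> V \<sigma>\<close>: \<open>\<sigma>\<close> is a never-zero section of \<open>\<Lambda>\<close> over the open set \<open>V\<close>.\<close>

definition lift ::
  "('m::topological_space) chart set \<Rightarrow> ('m \<Rightarrow> (real ^ 5) set) \<Rightarrow> 'm set \<Rightarrow> ('m \<Rightarrow> real ^ 5) \<Rightarrow> bool" where
  "lift A \<Lambda> V \<sigma> \<longleftrightarrow> open V \<and> smooth_section A V \<sigma> \<and> (\<forall>x\<in>V. \<sigma> x \<in> \<Lambda> x \<and> \<sigma> x \<noteq> 0)"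

definition null_line_subbundle ::
  "('m::topological_space) set \<Rightarrow> 'm chart set \<Rightarrow> ('m \<Rightarrow> (real ^ 5) set) \<Rightarrow> bool" where
  "null_line_subbundle M A \<Lambda> \<longleftrightarrow>
     (\<forall>p\<in>M. \<exists>V \<sigma>. p \<in> V \<and> V \<subseteq> M \<and> lift A \<Lambda> V \<sigma> \<and>
        (\<forall>x\<in>V. \<Lambda> x = span {\<sigma> x} \<and> \<sigma> x \<in> light_cone))"

text \<open>
  The differential at \<open>p\<close> of the map into projective space defined by a lift \<open>\<sigma>\<close> sends \<open>X\<close> to the
  class of the derivative of \<open>\<sigma>\<close> along \<open>X\<close> modulo \<open>\<Lambda> p\<close>.
\<close>

definition immersive ::
  "('m::topological_space) chart set \<Rightarrow> ('m \<Rightarrow> (real ^ 5) set) \<Rightarrow> bool" where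
  "immersive A \<Lambda> \<longleftrightarrow>
     (\<forall>\<kappa>\<in>A. \<forall>p\<in>dom_of \<kappa>. \<forall>V \<sigma>. p \<in> V \<and> lift A \<Lambda> V \<sigma> \<longrightarrow>
        (\<forall>X. X \<noteq> 0 \<longrightarrow> ddir (\<sigma> \<circ> param \<kappa>) X (coord \<kappa> p) \<notin> \<Lambda> p))"

text \<open>
  The 2-spheres of the conformal sphere are the sections of the light cone by the hyperplanes
  orthogonal to spacelike vectors.
\<close>

definition in_two_sphere :: "'m set \<Rightarrow> ('m \<Rightarrow> (real ^ 5) set) \<Rightarrow> bool" where
  "in_two_sphere M \<Lambda> \<longleftrightarrow> (\<exists>w. mink w w > 0 \<and> (\<forall>p\<in>M. \<Lambda> p \<subseteq> {u. mink u w = 0}))"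

definition conformal_surface ::
  "('m::topological_space) set \<Rightarrow> 'm chart set \<Rightarrow> ('m \<Rightarrow> (real ^ 5) set) \<Rightarrow> bool" where
  "conformal_surface M A \<Lambda> \<longleftrightarrow>
     null_line_subbundle M A \<Lambda> \<and> immersive A \<Lambda> \<and> \<not> in_two_sphere M \<Lambda>"

text \<open>The metric \<open>g\<^sub>\<sigma>\<close> in the chart \<open>\<kappa>\<close>, at the point with coordinate \<open>w\<close>.\<close>

definition metric_of ::
  "'m chart \<Rightarrow> ('m \<Rightarrow> real ^ 5) \<Rightarrow> complex \<Rightarrow> complex \<Rightarrow> complex \<Rightarrow> real" where
  "metric_of \<kappa> \<sigma> w X Y = mink (ddir (\<sigma> \<circ> param \<kappa>) X w) (ddir (\<sigma> \<circ> param \<kappa>) Y w)"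

text \<open>
  An oriented chart is a holomorphic chart of the conformal structure induced by \<open>\<Lambda>\<close> iff the
  metrics \<open>g\<^sub>\<sigma>\<close> are multiples of the Euclidean metric of the coordinate plane; here \<open>X \<bullet> Y\<close> is the
  real inner product of \<open>complex\<close>.  By the existence of isothermal coordinates every oriented
  surface with an immersion \<open>\<Lambda>\<close> has an atlas of holomorphic charts.
\<close>

definition holomorphic_chart ::
  "('m::topological_space) chart set \<Rightarrow> ('m \<Rightarrow> (real ^ 5) set) \<Rightarrow> 'm chart \<Rightarrow> bool" where
  "holomorphic_chart A \<Lambda> \<kappa> \<longleftrightarrow>
     (\<forall>p\<in>dom_of \<kappa>. \<forall>V \<sigma>. p \<in> V \<and> lift A \<Lambda> V \<sigma> \<longrightarrow>
        (\<exists>\<rho>>0. \<forall>X Y. metric_of \<kappa> \<sigma> (coord \<kappa> p) X Y = \<rho> * (X \<bullet> Y)))"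

definition holomorphic_atlas ::
  "('m::topological_space) chart set \<Rightarrow> ('m \<Rightarrow> (real ^ 5) set) \<Rightarrow> bool" where
  "holomorphic_atlas A \<Lambda> \<longleftrightarrow> (\<forall>\<kappa>\<in>A. holomorphic_chart A \<Lambda> \<kappa>)"


section \<open>The central sphere congruence\<close>

definition del_z :: "(complex \<Rightarrow> complex ^ 5) \<Rightarrow> complex \<Rightarrow> complex ^ 5" where
  "del_z f w = (1/2) *s (ddir f 1 w - \<i> *s ddir f \<i> w)"

definition del_zbar :: "(complex \<Rightarrow> complex ^ 5) \<Rightarrow> complex \<Rightarrow> complex ^ 5" where
  "del_zbar f w = (1/2) *s (ddir f 1 w + \<i> *s ddir f \<i> w)"

text \<open>
  The spans of \<open>\<sigma>, del_z \<sigma>, del_zbar \<sigma>\<close> and of \<open>\<sigma>, del_z \<sigma>, del_zbar \<sigma>, del_z (del_zbar \<sigma>)\<close> at a point depend neither on the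
  holomorphic chart nor on the lift \<open>\<sigma>\<close>.  To define them without singling out a chart and a lift,
  we take the span over all of them; the atlas \<open>A\<close> is meant to be holomorphic.
\<close>

definition Lambda1 ::
  "('m::topological_space) chart set \<Rightarrow> ('m \<Rightarrow> (real ^ 5) set) \<Rightarrow> 'm \<Rightarrow> (complex ^ 5) set" where
  "Lambda1 A \<Lambda> p = vec.span
     (\<Union>{ (let s = cvec \<circ> \<sigma> \<circ> param \<kappa>; w = coord \<kappa> p in {s w, del_z s w, del_zbar s w})
         | \<kappa> V \<sigma>. \<kappa> \<in> A \<and> p \<in> dom_of \<kappa> \<and> p \<in> V \<and> lift A \<Lambda> V \<sigma>})"

definition central_sphere ::
  "('m::topological_space) chart set \<Rightarrow> ('m \<Rightarrow> (real ^ 5) set) \<Rightarrow> 'm \<Rightarrow> (complex ^ 5) set" where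
  "central_sphere A \<Lambda> p = vec.span
     (\<Union>{ (let s = cvec \<circ> \<sigma> \<circ> param \<kappa>; w = coord \<kappa> p
           in {s w, del_z s w, del_zbar s w, del_z (del_zbar s) w})
         | \<kappa> V \<sigma>. \<kappa> \<in> A \<and> p \<in> dom_of \<kappa> \<and> p \<in> V \<and> lift A \<Lambda> V \<sigma>})"

definition real_central_sphere ::
  "('m::topological_space) chart set \<Rightarrow> ('m \<Rightarrow> (real ^ 5) set) \<Rightarrow> 'm \<Rightarrow> (real ^ 5) set" where
  "real_central_sphere A \<Lambda> p = {v. cvec v \<in> central_sphere A \<Lambda> p}"


section \<open>Forms and connections in a holomorphic chart\<close>

text \<open>
  In a chart, an endomorphism-valued 1-form takes a point, a real tangent vector (an element of
  the coordinate plane) and a vector of \<open>complex ^ 5\<close>.  In a holomorphic chart, \<open>J X = \<i> * X\<close>.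
\<close>

type_synonym endo_form = "complex \<Rightarrow> complex \<Rightarrow> complex ^ 5 \<Rightarrow> complex ^ 5"

definition part10 :: "endo_form \<Rightarrow> endo_form" where
  "part10 \<omega> w X v = (1/2) *s (\<omega> w X v - \<i> *s \<omega> w (\<i> * X) v)"

definition part01 :: "endo_form \<Rightarrow> endo_form" where
  "part01 \<omega> w X v = (1/2) *s (\<omega> w X v + \<i> *s \<omega> w (\<i> * X) v)"

definition star :: "endo_form \<Rightarrow> endo_form" where
  "star \<omega> w X v = - \<omega> w (\<i> * X) v"

text \<open>For the bundle \<open>S\<close> over a chart, \<open>conn_D S\<close> is \<open>\<D>\<close>.\<close>

definition conn_D ::
  "(complex \<Rightarrow> (complex ^ 5) set) \<Rightarrow> complex \<Rightarrow> (complex \<Rightarrow> complex ^ 5) \<Rightarrow> complex \<Rightarrow> complex ^ 5" where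
  "conn_D S X f w =
     proj (S w) (ddir (\<lambda>y. proj (S y) (f y)) X w) +
     proj (orth (S w)) (ddir (\<lambda>y. proj (orth (S y)) (f y)) X w)"

text \<open>
  \<open>\<N> = d - \<D>\<close> is tensorial, so its value at \<open>v\<close> is obtained by differentiating the
  constant section \<open>v\<close>.
\<close>

definition form_N :: "(complex \<Rightarrow> (complex ^ 5) set) \<Rightarrow> endo_form" where
  "form_N S w X v = ddir (\<lambda>_. v) X w - conn_D S X (\<lambda>_. v) w"

text \<open>The connection induced by \<open>\<D>\<close> on endomorphisms, again evaluated on constant sections.\<close>

definition conn_D_End ::
  "(complex \<Rightarrow> (complex ^ 5) set) \<Rightarrow> complex \<Rightarrow> (complex \<Rightarrow> complex ^ 5 \<Rightarrow> complex ^ 5) \<Rightarrow>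
   complex \<Rightarrow> complex ^ 5 \<Rightarrow> complex ^ 5" where
  "conn_D_End S X E w v = conn_D S X (\<lambda>y. E y v) w - E w (conn_D S X (\<lambda>_. v) w)"

text \<open>
  The exterior derivative, evaluated on the constant vector fields \<open>X\<close>, \<open>Y\<close> of the chart, whose
  Lie bracket vanishes.
\<close>

definition ext_D ::
  "(complex \<Rightarrow> (complex ^ 5) set) \<Rightarrow> endo_form \<Rightarrow> complex \<Rightarrow> complex \<Rightarrow> complex \<Rightarrow>
   complex ^ 5 \<Rightarrow> complex ^ 5" where
  "ext_D S \<omega> w X Y v =
     conn_D_End S X (\<lambda>y. \<omega> y Y) w v - conn_D_End S Y (\<lambda>y. \<omega> y X) w v"

definition wedge_bracket ::
  "endo_form \<Rightarrow> endo_form \<Rightarrow> complex \<Rightarrow> complex \<Rightarrow> complex \<Rightarrow> complex ^ 5 \<Rightarrow> complex ^ 5" where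
  "wedge_bracket \<mu> \<eta> w X Y v =
     (\<mu> w X (\<eta> w Y v) - \<eta> w Y (\<mu> w X v)) - (\<mu> w Y (\<eta> w X v) - \<eta> w X (\<mu> w Y v))"

text \<open>
  The associated connection of \<open>S\<close> and \<open>q\<close> with spectral parameter \<open>\<zeta>\<close>.
\<close>

definition conn_zeta ::
  "(complex \<Rightarrow> (complex ^ 5) set) \<Rightarrow> endo_form \<Rightarrow> complex \<Rightarrow>
   complex \<Rightarrow> (complex \<Rightarrow> complex ^ 5) \<Rightarrow> complex \<Rightarrow> complex ^ 5" where
  "conn_zeta S q \<zeta> X f w =
     conn_D S X f w
     + inverse \<zeta> *s part10 (form_N S) w X (f w)
     + \<zeta> *s part01 (form_N S) w X (f w)
     + (inverse (\<zeta>\<^sup>2) - 1) *s part10 q w X (f w)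
     + (\<zeta>\<^sup>2 - 1) *s part01 q w X (f w)"


section \<open>Constrained Willmore surfaces and conserved quantities\<close>

text \<open>
  A 1-form on the surface is given by its expressions in the charts of the atlas, which have to
  be related by pull-back along the transition maps.
\<close>

definition endo_one_form :: "'m chart set \<Rightarrow> ('m chart \<Rightarrow> endo_form) \<Rightarrow> bool" where
  "endo_one_form A q \<longleftrightarrow>
     (\<forall>\<kappa>\<in>A. \<forall>X v. smooth_on (coord \<kappa> ` dom_of \<kappa>) (\<lambda>w. q \<kappa> w X v)) \<and>
     (\<forall>\<kappa>\<in>A. \<forall>w\<in>coord \<kappa> ` dom_of \<kappa>. \<forall>v. linear (\<lambda>X. q \<kappa> w X v)) \<and>
     (\<forall>\<kappa>\<in>A. \<forall>\<kappa>'\<in>A. \<forall>p\<in>dom_of \<kappa> \<inter> dom_of \<kappa>'. \<forall>X.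
        q \<kappa> (coord \<kappa> p) X =
        q \<kappa>' (coord \<kappa>' p) (ddir (coord \<kappa>' \<circ> param \<kappa>) X (coord \<kappa> p)))"

text \<open>
  As \<open>\<Lambda>\<close> has rank one, every element of \<open>\<Lambda> \<and> Lambda1\<close> is decomposable.
\<close>

definition wedge_bundle ::
  "('m::topological_space) chart set \<Rightarrow> ('m \<Rightarrow> (real ^ 5) set) \<Rightarrow> 'm \<Rightarrow>
   (complex ^ 5 \<Rightarrow> complex ^ 5) set" where
  "wedge_bundle A \<Lambda> p = {wedge (cvec a) b | a b. a \<in> \<Lambda> p \<and> b \<in> Lambda1 A \<Lambda> p}"

definition real_form_in ::
  "('m::topological_space) chart set \<Rightarrow> ('m \<Rightarrow> (complex ^ 5 \<Rightarrow> complex ^ 5) set) \<Rightarrow>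
   ('m chart \<Rightarrow> endo_form) \<Rightarrow> bool" where
  "real_form_in A B q \<longleftrightarrow> endo_one_form A q \<and>
     (\<forall>\<kappa>\<in>A. \<forall>p\<in>dom_of \<kappa>. \<forall>X.
        q \<kappa> (coord \<kappa> p) X \<in> B p \<and>
        (\<forall>v. q \<kappa> (coord \<kappa> p) X (cnj_vec v) = cnj_vec (q \<kappa> (coord \<kappa> p) X v)))"

definition constrained_Willmore ::
  "('m::topological_space) chart set \<Rightarrow> ('m \<Rightarrow> (real ^ 5) set) \<Rightarrow> ('m chart \<Rightarrow> endo_form) \<Rightarrow> bool" where
  "constrained_Willmore A \<Lambda> q \<longleftrightarrow>
     real_form_in A (wedge_bundle A \<Lambda>) q \<and>
     (\<forall>\<kappa>\<in>A. \<forall>w\<in>coord \<kappa> ` dom_of \<kappa>. \<forall>X Y v.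
        let S = central_sphere A \<Lambda> \<circ> param \<kappa>
        in ext_D S (q \<kappa>) w X Y v = 0 \<and>
           ext_D S (star (form_N S)) w X Y v =
             2 *s wedge_bracket (q \<kappa>) (star (form_N S)) w X Y v)"

definition conserved_quantity ::
  "('m::topological_space) set \<Rightarrow> 'm chart set \<Rightarrow> ('m \<Rightarrow> (real ^ 5) set) \<Rightarrow>
   ('m chart \<Rightarrow> endo_form) \<Rightarrow> (complex \<Rightarrow> 'm \<Rightarrow> complex ^ 5) \<Rightarrow> bool" where
  "conserved_quantity M A \<Lambda> q p \<longleftrightarrow>
     constrained_Willmore A \<Lambda> q \<and>
     (\<exists>(v\<^sub>0 :: 'm \<Rightarrow> real ^ 5) v.
        smooth_section A M v\<^sub>0 \<and> (\<forall>x\<in>M. v\<^sub>0 x \<in> real_central_sphere A \<Lambda> x) \<and>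
        smooth_section A M v \<and> (\<forall>x\<in>M. v x \<in> orth (central_sphere A \<Lambda> x)) \<and>
        (\<forall>\<zeta>. \<zeta> \<noteq> 0 \<longrightarrow>
           (\<forall>x\<in>M. p \<zeta> x = inverse \<zeta> *s v x + cvec (v\<^sub>0 x) + \<zeta> *s cnj_vec (v x)))) \<and>
     (\<forall>x\<in>M. p 1 x \<noteq> 0) \<and>
     (\<forall>\<zeta>. \<zeta> \<noteq> 0 \<longrightarrow>
        (\<forall>\<kappa>\<in>A. \<forall>w\<in>coord \<kappa> ` dom_of \<kappa>. \<forall>X.
           conn_zeta (central_sphere A \<Lambda> \<circ> param \<kappa>) (q \<kappa>) \<zeta> X (p \<zeta> \<circ> param \<kappa>) w = 0))"


section \<open>Surfaces of constant mean curvature in a space-form\<close>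

definition v_tan ::
  "('m::topological_space) chart set \<Rightarrow> ('m \<Rightarrow> (real ^ 5) set) \<Rightarrow> real ^ 5 \<Rightarrow> 'm \<Rightarrow> real ^ 5" where
  "v_tan A \<Lambda> vinf p = proj (real_central_sphere A \<Lambda> p) vinf"

definition v_perp ::
  "('m::topological_space) chart set \<Rightarrow> ('m \<Rightarrow> (real ^ 5) set) \<Rightarrow> real ^ 5 \<Rightarrow> 'm \<Rightarrow> real ^ 5" where
  "v_perp A \<Lambda> vinf p = proj (orth (real_central_sphere A \<Lambda> p)) vinf"

definition mean_curvature ::
  "('m::topological_space) chart set \<Rightarrow> ('m \<Rightarrow> (real ^ 5) set) \<Rightarrow> real ^ 5 \<Rightarrow> 'm \<Rightarrow> real" where
  "mean_curvature A \<Lambda> vinf p = sqrt (mink (v_perp A \<Lambda> vinf p) (v_perp A \<Lambda> vinf p))"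

text \<open>
  \<open>\<Lambda>\<close> defines a surface in the space-form only where \<open>\<Lambda>\<close> meets it, that is, away from the zeros
  of \<open>mink \<sigma> vinf\<close>.
\<close>

definition surface_in_space_form :: "'m set \<Rightarrow> ('m \<Rightarrow> (real ^ 5) set) \<Rightarrow> real ^ 5 \<Rightarrow> bool" where
  "surface_in_space_form M \<Lambda> vinf \<longleftrightarrow> (\<forall>p\<in>M. \<Lambda> p \<inter> space_form vinf \<noteq> {})"

definition constant_mean_curvature ::
  "('m::topological_space) set \<Rightarrow> 'm chart set \<Rightarrow> ('m \<Rightarrow> (real ^ 5) set) \<Rightarrow> real ^ 5 \<Rightarrow> bool" where
  "constant_mean_curvature M A \<Lambda> vinf \<longleftrightarrow>
     surface_in_space_form M \<Lambda> vinf \<and> mean_curvature A \<Lambda> vinf constant_on M"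

text \<open>The value does not depend on the chosen non-zero element of the line \<open>\<Lambda> p\<close>.\<close>

definition sigma_inf :: "('m \<Rightarrow> (real ^ 5) set) \<Rightarrow> real ^ 5 \<Rightarrow> 'm \<Rightarrow> real ^ 5" where
  "sigma_inf \<Lambda> vinf p =
     (let \<sigma> = (SOME u. u \<in> \<Lambda> p \<and> u \<noteq> 0) in - (1 / mink \<sigma> vinf) *\<^sub>R \<sigma>)"

definition unit_normal ::
  "('m::topological_space) set \<Rightarrow> 'm chart set \<Rightarrow> ('m \<Rightarrow> (real ^ 5) set) \<Rightarrow> real ^ 5 \<Rightarrow>
   ('m \<Rightarrow> real ^ 5) \<Rightarrow> bool" where
  "unit_normal M A \<Lambda> vinf N \<longleftrightarrow>
     smooth_section A M N \<and>
     (\<forall>p\<in>M. N p \<in> orth (real_central_sphere A \<Lambda> p) \<and> mink (N p) (N p) = 1 \<and>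
        v_perp A \<Lambda> vinf p = mean_curvature A \<Lambda> vinf p *\<^sub>R N p)"

definition eta_inf ::
  "('m \<Rightarrow> (real ^ 5) set) \<Rightarrow> real ^ 5 \<Rightarrow> ('m \<Rightarrow> real ^ 5) \<Rightarrow> 'm chart \<Rightarrow> endo_form" where
  "eta_inf \<Lambda> vinf N \<kappa> w X v =
     (1/2) *s wedge (cvec (sigma_inf \<Lambda> vinf (param \<kappa> w))) (cvec (ddir (N \<circ> param \<kappa>) X w)) v"

definition q_inf ::
  "('m::topological_space) chart set \<Rightarrow> ('m \<Rightarrow> (real ^ 5) set) \<Rightarrow> real ^ 5 \<Rightarrow> ('m \<Rightarrow> real ^ 5) \<Rightarrow>
   'm chart \<Rightarrow> endo_form" where
  "q_inf A \<Lambda> vinf N \<kappa> w X v =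
     complex_of_real (mean_curvature A \<Lambda> vinf (param \<kappa> w)) *s eta_inf \<Lambda> vinf N \<kappa> w X v"

definition p_inf ::
  "('m::topological_space) chart set \<Rightarrow> ('m \<Rightarrow> (real ^ 5) set) \<Rightarrow> real ^ 5 \<Rightarrow>
   complex \<Rightarrow> 'm \<Rightarrow> complex ^ 5" where
  "p_inf A \<Lambda> vinf \<zeta> x =
     inverse \<zeta> *s ((1/2) *s cvec (v_perp A \<Lambda> vinf x)) + cvec (v_tan A \<Lambda> vinf x)
     + \<zeta> *s ((1/2) *s cvec (v_perp A \<Lambda> vinf x))"

end

theory Submission
  imports Defs
begin

text \<open>
  The central sphere congruence is the orthogonal complement of the complexified unit normal \<open>N\<close>,
  so that \<open>\<N> = N \<and> dN\<close> and \<open>\<D>\<close> is explicit.  As \<open>\<sigma>\<^sub>\<infinity>\<close> and \<open>N\<close> have constant products with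
  \<open>v\<^sub>\<infinity>\<close>, \<open>dN\<close> has no component along \<open>\<sigma>\<^sub>\<infinity>\<close>: it is \<open>d\<sigma>\<^sub>\<infinity>\<close> followed by a trace-free symmetric
  endomorphism, which gives \<open>d\<sigma>\<^sub>\<infinity> \<and> dN = 0\<close> and hence the first equation for \<open>q\<^sub>\<infinity>\<close>.  The Laplacian of
  \<open>N\<close> is orthogonal to \<open>\<sigma>\<^sub>\<infinity>\<close> and \<open>d\<sigma>\<^sub>\<infinity>\<close>, so pairing with \<open>N\<close> and \<open>v\<^sub>\<infinity>\<close> determines it as a multiple of
  \<open>N + H\<^sub>\<infinity> \<sigma>\<^sub>\<infinity>\<close>; this is the second equation.  Finally
  \<open>p\<^sub>\<infinity>(\<lambda>) = v\<^sub>\<infinity> + H\<^sub>\<infinity> ((\<lambda> + 1/\<lambda>)/2 - 1) N\<close>, and in its derivative the coefficients of \<open>dN\<close> cancel.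
\<close>

section \<open>Calculus of \<open>Ck_on\<close>\<close>

text \<open>\<open>central_sphere\<close> is a span over all charts and lifts, so no single lift
  visibly describes it. The unit normal \<open>N\<close> resolves this: it is orthogonal to the
  whole span, which bounds the span by a bundle of rank four, and the one global lift
  \<open>sigma_inf\<close> already fills that bundle. In a chart only two functions
  \<open>s\<close>, \<open>n\<close> into \<open>real ^ 5\<close> remain, and the geometry becomes
  the differentiation of constant products plus the symmetry of second derivatives.

  That the Laplacian of \<open>N\<close> is orthogonal to the derivatives of
  \<open>sigma_inf\<close> is the Codazzi equation; the derivatives of the conformal factor cancel
  in it because the shape operator is symmetric and trace-free.

  The cancellation in the last step: with \<open>H\<close> the mean curvature, \<open>p\<close>
  pairs with \<open>sigma_inf\<close>, \<open>N\<close>, \<open>dN\<close> to \<open>-1\<close>,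
  \<open>H (\<lambda> + 1/\<lambda>)/2\<close>, \<open>0\<close>. So the splitting connection, its
  complement and \<open>q\<close> send \<open>p\<close> to \<open>-H dN\<close>,
  \<open>H (\<lambda> + 1/\<lambda>)/2 dN\<close>, \<open>-H/2 dN\<close>, and the (1,0)-coefficient
  is \<open>-H + H (1 + \<lambda>^-2)/2 - H (\<lambda>^-2 - 1)/2 = 0\<close>.

  For \<open>H = 0\<close> the vector \<open>v_perp\<close> says nothing about \<open>N\<close>, but
  the identity \<open>(N, v_inf) = H\<close> survives, and the argument rests on it.\<close>

lemma ddir_eq: "(f has_derivative f') (at w) \<Longrightarrow> ddir f X w = f' X"
  by (simp add: ddir_def frechet_derivative_at[symmetric])

lemma has_derivative_ddir: "f differentiable (at w) \<Longrightarrow> (f has_derivative (\<lambda>X. ddir f X w)) (at w)"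
  using frechet_derivative_works[of f "at w"] by (simp add: ddir_def)

lemma linear_ddir: "f differentiable (at w) \<Longrightarrow> linear (\<lambda>X. ddir f X w)"
  by (rule has_derivative_linear[OF has_derivative_ddir])

lemma differentiable_cong_open:
  assumes "open U" "w \<in> U" "\<And>y. y \<in> U \<Longrightarrow> f y = g y" "g differentiable (at w)"
  shows "f differentiable (at w)"
  using has_derivative_transform_within_open[of g _ w UNIV U f] assms unfolding differentiable_def by metis

text \<open>Differentiability is not assumed because \<open>conn_D\<close> differentiates projected
  sections unconditionally, and those projections are to be replaced by explicit formulas before
  anything is known about them.\<close>

lemma ddir_cong_open:
  assumes "open U" "w \<in> U" "\<And>y. y \<in> U \<Longrightarrow> f y = g y"
  shows "ddir f X w = ddir g X w"
proof (cases "g differentiable (at w)")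
  case True
  then show ?thesis
    using frechet_derivative_transform_within_open[of g w U f] assms by (simp add: ddir_def)
next
  case False
  then have "\<not> f differentiable (at w)"
    using differentiable_cong_open[of U w g f] assms by auto
  \<comment> \<open>Neither function has a derivative, so the two predicates agree (both are
    constantly false) and \<open>frechet_derivative\<close> makes the same arbitrary choice for
    both.\<close>
  then have "(\<lambda>f'. (f has_derivative f') (at w)) = (\<lambda>f'. (g has_derivative f') (at w))"
    using False by (auto simp: differentiable_def)
  then show ?thesis by (simp add: ddir_def frechet_derivative_def)
qed

lemma Ck_on_cong:
  assumes "open U" "\<And>w. w \<in> U \<Longrightarrow> f w = g w"
  shows "Ck_on k U f \<longleftrightarrow> Ck_on k U g"
  using assms(2)
proof (induction k arbitrary: f g)
  case 0
  then show ?case by (simp cong: continuous_on_cong)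
next
  case (Suc k)
  have "Ck_on k U (ddir f X) = Ck_on k U (ddir g X)" for X
    using Suc.prems by (intro Suc.IH ddir_cong_open[OF assms(1)]) auto
  moreover have "f differentiable (at w) \<longleftrightarrow> g differentiable (at w)" if "w \<in> U" for w
    using differentiable_cong_open[OF assms(1) that, of f g] Suc.prems
      differentiable_cong_open[OF assms(1) that, of g f] by auto
  ultimately show ?case by auto
qed

lemma Ck_on_congI:
  assumes "open U" "\<And>w. w \<in> U \<Longrightarrow> f w = g w" "Ck_on k U g"
  shows "Ck_on k U f"
  using Ck_on_cong[of U f g k] assms by simp

lemma Ck_on_SucD: "Ck_on (Suc k) U f \<Longrightarrow> Ck_on k U f"
proof (induction k arbitrary: f)
  case 0
  then show ?case
    by (auto intro!: continuous_at_imp_continuous_on differentiable_imp_continuous_within)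
next
  case (Suc k)
  then show ?case by simp
qed

lemma Ck_on_subset: "Ck_on k U f \<Longrightarrow> V \<subseteq> U \<Longrightarrow> Ck_on k V f"
  by (induction k arbitrary: f) (auto intro: continuous_on_subset)

lemma smooth_on_subset: "smooth_on U f \<Longrightarrow> V \<subseteq> U \<Longrightarrow> smooth_on V f"
  by (auto simp: smooth_on_def intro: Ck_on_subset)

text \<open>Lifts of the surface exist only locally, so the smoothness of \<open>sigma_inf\<close>
  in a chart has to be glued from neighbourhoods.\<close>

lemma Ck_on_local:
  assumes "\<And>w. w \<in> U \<Longrightarrow> \<exists>V. open V \<and> w \<in> V \<and> Ck_on k V f"
  shows "Ck_on k U f"
  using assms
proof (induction k arbitrary: f)
  case 0
  show ?case unfolding Ck_on.simps
  proof (rule continuous_at_imp_continuous_on, rule ballI)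
    fix w assume "w \<in> U"
    then obtain V where "open V" "w \<in> V" "continuous_on V f"
      using 0[of w] by auto
    then show "isCont f w" by (simp add: continuous_on_eq_continuous_at)
  qed
next
  case (Suc k)
  show ?case unfolding Ck_on.simps
  proof (intro conjI ballI allI)
    fix w assume "w \<in> U"
    then show "f differentiable (at w)" using Suc.prems[of w] by auto
  next
    fix X
    show "Ck_on k U (ddir f X)"
    proof (rule Suc.IH)
      fix w assume "w \<in> U"
      then show "\<exists>V. open V \<and> w \<in> V \<and> Ck_on k V (ddir f X)"
        using Suc.prems[of w] by auto
    qed
  qed
qed

lemma smooth_on_local:
  assumes "\<And>w. w \<in> U \<Longrightarrow> \<exists>V. open V \<and> w \<in> V \<and> smooth_on V f"
  shows "smooth_on U f"
  unfolding smooth_on_def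
proof (intro allI Ck_on_local)
  fix k w assume "w \<in> U"
  then show "\<exists>V. open V \<and> w \<in> V \<and> Ck_on k V f"
    using assms[of w] by (auto simp: smooth_on_def)
qed

lemma smooth_on_congI:
  assumes "open U" "smooth_on U g" "\<And>w. w \<in> U \<Longrightarrow> f w = g w"
  shows "smooth_on U f"
  using assms(2) unfolding smooth_on_def by (auto intro: Ck_on_congI[OF assms(1,3)])

lemma smooth_on_differentiable: "smooth_on U f \<Longrightarrow> w \<in> U \<Longrightarrow> f differentiable (at w)"
  unfolding smooth_on_def using Ck_on.simps(2) by blast

lemma smooth_on_ddir: "smooth_on U f \<Longrightarrow> smooth_on U (ddir f X)"
  unfolding smooth_on_def using Ck_on.simps(2) by blast

lemma Ck_on_const: "Ck_on k U (\<lambda>_. c)"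
proof (induction k arbitrary: c)
  case (Suc k)
  have "ddir (\<lambda>_::'a. c) X = (\<lambda>_. 0)" for X by (simp add: ddir_def fun_eq_iff)
  with Suc show ?case by simp
qed simp

lemma smooth_on_const [intro, simp]: "smooth_on U (\<lambda>_. c)"
  by (simp add: smooth_on_def Ck_on_const)

lemma ddir_const [simp]: "ddir (\<lambda>_. c) X w = 0"
  by (simp add: ddir_def)

lemma ddir_linear:
  assumes "bounded_linear L" "f differentiable (at w)"
  shows "ddir (\<lambda>y. L (f y)) X w = L (ddir f X w)"
  by (rule ddir_eq, rule bounded_linear.has_derivative[OF assms(1) has_derivative_ddir[OF assms(2)]])

lemma ddir_add:
  assumes "f differentiable (at w)" "g differentiable (at w)"
  shows "ddir (\<lambda>y. f y + g y) X w = ddir f X w + ddir g X w"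
  by (rule ddir_eq) (intro has_derivative_add has_derivative_ddir assms)

lemma ddir_diff:
  assumes "f differentiable (at w)" "g differentiable (at w)"
  shows "ddir (\<lambda>y. f y - g y) X w = ddir f X w - ddir g X w"
  by (rule ddir_eq) (intro has_derivative_diff has_derivative_ddir assms)

lemma ddir_bilinear:
  assumes "bounded_bilinear B" "f differentiable (at w)" "g differentiable (at w)"
  shows "ddir (\<lambda>y. B (f y) (g y)) X w = B (f w) (ddir g X w) + B (ddir f X w) (g w)"
  by (rule ddir_eq, rule bounded_bilinear.FDERIV[OF assms(1)]) (intro has_derivative_ddir assms)+

lemma differentiable_bilinear:
  assumes "bounded_bilinear B" "f differentiable (at w)" "g differentiable (at w)"
  shows "(\<lambda>y. B (f y) (g y)) differentiable (at w)"
  using bounded_bilinear.FDERIV[OF assms(1)] assms(2,3) unfolding differentiable_def by blast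

lemma differentiable_linear:
  assumes "bounded_linear L" "f differentiable (at w)"
  shows "(\<lambda>y. L (f y)) differentiable (at w)"
  using bounded_linear.has_derivative[OF assms(1)] assms(2) unfolding differentiable_def by blast

lemma Ck_on_linear:
  assumes "open U" "bounded_linear L" "Ck_on k U f"
  shows "Ck_on k U (\<lambda>w. L (f w))"
  using assms(3)
proof (induction k arbitrary: f)
  case 0
  then show ?case using bounded_linear.continuous_on[OF assms(2)] by simp
next
  case (Suc k)
  have "ddir (\<lambda>w. L (f w)) X w = L (ddir f X w)" if "w \<in> U" for X w
    using Suc.prems that by (simp add: ddir_linear[OF assms(2)])
  moreover have "Ck_on k U (\<lambda>w. L (ddir f X w))" for X
    using Suc.prems by (intro Suc.IH) simp
  ultimately have "Ck_on k U (ddir (\<lambda>w. L (f w)) X)" for X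
    by (rule Ck_on_congI[OF assms(1)])
  moreover have "(\<lambda>w. L (f w)) differentiable (at w)" if "w \<in> U" for w
    using Suc.prems that by (simp add: differentiable_linear[OF assms(2)])
  ultimately show ?case by simp
qed

lemma Ck_on_add:
  assumes "open U" "Ck_on k U f" "Ck_on k U g"
  shows "Ck_on k U (\<lambda>w. f w + g w)"
  using assms(2,3)
proof (induction k arbitrary: f g)
  case 0
  then show ?case by (simp add: continuous_on_add)
next
  case (Suc k)
  have "ddir (\<lambda>w. f w + g w) X w = ddir f X w + ddir g X w" if "w \<in> U" for X w
    using Suc.prems that by (intro ddir_add) simp_all
  moreover have "Ck_on k U (\<lambda>w. ddir f X w + ddir g X w)" for X
    using Suc.prems by (intro Suc.IH) simp_all
  ultimately have "Ck_on k U (ddir (\<lambda>w. f w + g w) X)" for X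
    by (rule Ck_on_congI[OF assms(1)])
  then show ?case using Suc.prems by (simp add: differentiable_add)
qed

lemma Ck_on_bilinear:
  assumes "open U" "bounded_bilinear B" "Ck_on k U f" "Ck_on k U g"
  shows "Ck_on k U (\<lambda>w. B (f w) (g w))"
  using assms(3,4)
proof (induction k arbitrary: f g)
  case 0
  then show ?case using bounded_bilinear.continuous_on[OF assms(2)] by simp
next
  case (Suc k)
  have "Ck_on k U (\<lambda>w. B (f w) (ddir g X w) + B (ddir f X w) (g w))" for X
    using Suc.prems Ck_on_SucD[OF Suc.prems(1)] Ck_on_SucD[OF Suc.prems(2)]
    by (intro Ck_on_add assms(1) Suc.IH) simp_all
  then have "Ck_on k U (ddir (\<lambda>w. B (f w) (g w)) X)" for X
  proof (rule Ck_on_congI[OF assms(1), rotated])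
    fix w assume "w \<in> U"
    then show "ddir (\<lambda>w. B (f w) (g w)) X w = B (f w) (ddir g X w) + B (ddir f X w) (g w)"
      using Suc.prems by (simp add: ddir_bilinear[OF assms(2)])
  qed
  moreover have "(\<lambda>w. B (f w) (g w)) differentiable (at w)" if "w \<in> U" for w
    using Suc.prems that by (simp add: differentiable_bilinear[OF assms(2)])
  ultimately show ?case by simp
qed

text \<open>The derivative of \<open>1/f\<close> is \<open>-(1/f) f' (1/f)\<close>, so the
  reciprocal at order \<open>k\<close> feeds its own order \<open>k + 1\<close>; hence
  \<open>f\<close> stays fixed in the induction.\<close>

lemma Ck_on_inverse:
  fixes f :: "'a::real_normed_vector \<Rightarrow> real"
  assumes "open U" "\<And>w. w \<in> U \<Longrightarrow> f w \<noteq> 0" "Ck_on k U f"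
  shows "Ck_on k U (\<lambda>w. inverse (f w))"
  using assms(3)
proof (induction k)
  case 0
  then show ?case using assms(2) by (auto intro!: continuous_on_inverse)
next
  case (Suc k)
  let ?i = "\<lambda>w. inverse (f w)"
  have i: "Ck_on k U ?i" by (rule Suc.IH[OF Ck_on_SucD[OF Suc.prems]])
  have der: "(?i has_derivative (\<lambda>X. - (?i w * ddir f X w * ?i w))) (at w)" if "w \<in> U" for w
    using Suc.prems that assms(2)
    by (intro Deriv.has_derivative_inverse has_derivative_ddir) auto
  have "Ck_on k U (\<lambda>w. - (?i w * ddir f X w * ?i w))" for X
    using Suc.prems i
    by (intro Ck_on_linear[OF assms(1) bounded_linear_minus[OF bounded_linear_ident]]
        Ck_on_bilinear[OF assms(1) bounded_bilinear_mult]) simp_all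
  then have "Ck_on k U (ddir ?i X)" for X
    by (rule Ck_on_congI[OF assms(1), rotated]) (rule ddir_eq[OF der])
  with der show ?case by (auto simp: differentiable_def)
qed

lemma smooth_on_linear: "open U \<Longrightarrow> bounded_linear L \<Longrightarrow> smooth_on U f \<Longrightarrow> smooth_on U (\<lambda>w. L (f w))"
  by (simp add: smooth_on_def Ck_on_linear)

lemma smooth_on_add: "open U \<Longrightarrow> smooth_on U f \<Longrightarrow> smooth_on U g \<Longrightarrow> smooth_on U (\<lambda>w. f w + g w)"
  by (simp add: smooth_on_def Ck_on_add)

lemma smooth_on_bilinear:
  "open U \<Longrightarrow> bounded_bilinear B \<Longrightarrow> smooth_on U f \<Longrightarrow> smooth_on U g \<Longrightarrow> smooth_on U (\<lambda>w. B (f w) (g w))"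
  by (simp add: smooth_on_def Ck_on_bilinear)

lemma smooth_on_inverse:
  fixes f :: "'a::real_normed_vector \<Rightarrow> real"
  shows "open U \<Longrightarrow> (\<And>w. w \<in> U \<Longrightarrow> f w \<noteq> 0) \<Longrightarrow> smooth_on U f \<Longrightarrow> smooth_on U (\<lambda>w. inverse (f w))"
  by (simp add: smooth_on_def Ck_on_inverse)

lemma smooth_on_diff:
  assumes "open U" "smooth_on U f" "smooth_on U g"
  shows "smooth_on U (\<lambda>w. f w - g w)"
  using smooth_on_add[OF assms(1,2) smooth_on_linear[OF assms(1) bounded_linear_minus[OF bounded_linear_ident] assms(3)]]
  by simp

section \<open>Symmetry of second derivatives\<close>

lemma directional_mvt:
  fixes f :: "'a::real_normed_vector \<Rightarrow> real"
  assumes "0 < h" "\<And>t. 0 \<le> t \<Longrightarrow> t \<le> h \<Longrightarrow> f differentiable (at (a + t *\<^sub>R X))"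
  obtains \<xi> where "0 < \<xi>" "\<xi> < h" "f (a + h *\<^sub>R X) - f a = h * ddir f X (a + \<xi> *\<^sub>R X)"
proof -
  have "((\<lambda>t. f (a + t *\<^sub>R X)) has_real_derivative ddir f X (a + t *\<^sub>R X)) (at t)"
    if "0 \<le> t" "t \<le> h" for t
  proof -
    have "((\<lambda>t. f (a + t *\<^sub>R X)) has_derivative (\<lambda>r. ddir f (r *\<^sub>R X) (a + t *\<^sub>R X))) (at t)"
      by (rule has_derivative_compose[where g = f and g' = "\<lambda>Z. ddir f Z (a + t *\<^sub>R X)"])
         (auto intro!: derivative_eq_intros has_derivative_ddir assms(2) that)
    then show ?thesis
      using linear_scale[OF linear_ddir[OF assms(2)[OF that]]]
      by (simp add: has_field_derivative_def mult_commute_abs)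
  qed
  from MVT2[OF assms(1) this] that show ?thesis by auto
qed

text \<open>Two mean value steps: the increment of \<open>f\<close> along \<open>h Y\<close>, as a
  function of the base point, is varied in direction \<open>X\<close>; the resulting increment of
  \<open>ddir f X\<close> is then varied in direction \<open>Y\<close>.\<close>

lemma second_difference:
  fixes f :: "'a::real_normed_vector \<Rightarrow> real"
  assumes "Ck_on 2 U f" "0 < h"
    and "\<And>s t. 0 \<le> s \<Longrightarrow> s \<le> h \<Longrightarrow> 0 \<le> t \<Longrightarrow> t \<le> h \<Longrightarrow> w + s *\<^sub>R X + t *\<^sub>R Y \<in> U"
  obtains \<xi> \<eta> where "0 < \<xi>" "\<xi> < h" "0 < \<eta>" "\<eta> < h"
    "f (w + h *\<^sub>R X + h *\<^sub>R Y) - f (w + h *\<^sub>R X) - f (w + h *\<^sub>R Y) + f w =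
       h * h * ddir (ddir f X) Y (w + \<xi> *\<^sub>R X + \<eta> *\<^sub>R Y)"
proof -
  have d1: "f differentiable (at x)" and d2: "ddir f X differentiable (at x)" if "x \<in> U" for x
    using assms(1) that by (auto simp: numeral_2_eq_2)
  let ?g = "\<lambda>y. f (y + h *\<^sub>R Y) - f y"
  have tr: "((\<lambda>y. f (y + h *\<^sub>R Y)) has_derivative (\<lambda>Z. ddir f Z (w + t *\<^sub>R X + h *\<^sub>R Y))) (at (w + t *\<^sub>R X))"
    if "0 \<le> t" "t \<le> h" for t
    by (rule has_derivative_compose[where g = f and g' = "\<lambda>Z. ddir f Z (w + t *\<^sub>R X + h *\<^sub>R Y)"])
       (use that assms(2) assms(3)[of t h] in \<open>auto intro!: derivative_eq_intros has_derivative_ddir d1\<close>)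
  have fx: "(f has_derivative (\<lambda>Z. ddir f Z (w + t *\<^sub>R X))) (at (w + t *\<^sub>R X))"
    if "0 \<le> t" "t \<le> h" for t
    using that assms(2) assms(3)[of t 0] by (simp add: has_derivative_ddir d1)
  have dg: "(?g has_derivative (\<lambda>Z. ddir f Z (w + t *\<^sub>R X + h *\<^sub>R Y) - ddir f Z (w + t *\<^sub>R X))) (at (w + t *\<^sub>R X))"
    if "0 \<le> t" "t \<le> h" for t
    by (rule has_derivative_diff[OF tr[OF that] fx[OF that]])
  obtain \<xi> where \<xi>: "0 < \<xi>" "\<xi> < h" "?g (w + h *\<^sub>R X) - ?g w = h * ddir ?g X (w + \<xi> *\<^sub>R X)"
    using directional_mvt[of h ?g w X] assms(2) dg by (auto simp: differentiable_def)
  have "ddir ?g X (w + \<xi> *\<^sub>R X) = ddir f X (w + \<xi> *\<^sub>R X + h *\<^sub>R Y) - ddir f X (w + \<xi> *\<^sub>R X)"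
    using \<xi> by (intro ddir_eq[OF dg]) auto
  moreover obtain \<eta> where \<eta>: "0 < \<eta>" "\<eta> < h"
    "ddir f X (w + \<xi> *\<^sub>R X + h *\<^sub>R Y) - ddir f X (w + \<xi> *\<^sub>R X)
       = h * ddir (ddir f X) Y (w + \<xi> *\<^sub>R X + \<eta> *\<^sub>R Y)"
  proof (rule directional_mvt[OF assms(2), of "ddir f X" "w + \<xi> *\<^sub>R X" Y])
    fix t :: real assume "0 \<le> t" "t \<le> h"
    with \<xi> show "ddir f X differentiable (at (w + \<xi> *\<^sub>R X + t *\<^sub>R Y))"
      by (intro d2 assms(3)) auto
  qed
  ultimately show ?thesis using that[OF \<xi>(1,2) \<eta>(1,2)] \<xi>(3) by (simp add: algebra_simps)
qed

text \<open>The second difference over a small parallelogram is symmetric in \<open>X\<close> and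
  \<open>Y\<close>. It therefore equals values of both mixed derivatives at nearby points, and
  continuity forbids a gap between them.\<close>

lemma ddir_commute_real:
  fixes f :: "'a::real_normed_vector \<Rightarrow> real"
  assumes "open U" "w \<in> U" "Ck_on 2 U f"
  shows "ddir (ddir f X) Y w = ddir (ddir f Y) X w"
proof (rule ccontr)
  let ?P = "ddir (ddir f X) Y" and ?Q = "ddir (ddir f Y) X"
  assume neq: "?P w \<noteq> ?Q w"
  \<comment> \<open>Half the gap: two errors below \<open>e\<close> add up to less than the gap,
    which is the contradiction.\<close>
  define e where "e = \<bar>?P w - ?Q w\<bar> / 2"
  have "e > 0" using neq by (simp add: e_def)
  have "isCont ?P w" "isCont ?Q w"
    using assms by (auto simp: numeral_2_eq_2 continuous_on_eq_continuous_at)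
  then have "\<forall>\<^sub>F y in nhds w. dist (?P y) (?P w) < e" "\<forall>\<^sub>F y in nhds w. dist (?Q y) (?Q w) < e"
    using \<open>e > 0\<close> by (auto simp: continuous_at_eps_delta eventually_nhds_metric)
  moreover have "\<forall>\<^sub>F y in nhds w. y \<in> U" using assms by (simp add: eventually_nhds_in_open)
  ultimately have "\<forall>\<^sub>F y in nhds w. y \<in> U \<and> dist (?P y) (?P w) < e \<and> dist (?Q y) (?Q w) < e"
    by eventually_elim auto
  then obtain r where r: "r > 0"
    "\<And>y. dist y w < r \<Longrightarrow> y \<in> U \<and> dist (?P y) (?P w) < e \<and> dist (?Q y) (?Q w) < e"
    by (auto simp: eventually_nhds_metric)
  \<comment> \<open>Chosen so that the parallelogram with sides \<open>h X\<close>,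
    \<open>h Y\<close> lies in the ball of radius \<open>r\<close>; the \<open>1\<close> keeps the
    denominator positive and the estimate strict.\<close>
  define h where "h = r / (norm X + norm Y + 1)"
  have np: "norm X + norm Y + 1 > 0" by (simp add: add_nonneg_pos)
  have "h > 0" using r np by (simp add: h_def)
  have near: "dist (w + s *\<^sub>R X + t *\<^sub>R Y) w < r" if "0 \<le> s" "s \<le> h" "0 \<le> t" "t \<le> h" for s t
  proof -
    have "dist (w + s *\<^sub>R X + t *\<^sub>R Y) w = norm (s *\<^sub>R X + t *\<^sub>R Y)" by (simp add: dist_norm)
    also have "\<dots> \<le> s * norm X + t * norm Y"
      using norm_triangle_ineq[of "s *\<^sub>R X" "t *\<^sub>R Y"] that by simp
    also have "\<dots> \<le> h * norm X + h * norm Y"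
      using that by (intro add_mono mult_right_mono) auto
    also have "\<dots> < h * (norm X + norm Y + 1)" using \<open>h > 0\<close> by (simp add: algebra_simps)
    also have "\<dots> = r" using np by (simp add: h_def)
    finally show ?thesis .
  qed
  obtain a b where ab: "0 < a" "a < h" "0 < b" "b < h"
    "f (w + h *\<^sub>R X + h *\<^sub>R Y) - f (w + h *\<^sub>R X) - f (w + h *\<^sub>R Y) + f w = h * h * ?P (w + a *\<^sub>R X + b *\<^sub>R Y)"
  proof (rule second_difference[OF assms(3) \<open>h > 0\<close>, of w X Y])
    show "w + s *\<^sub>R X + t *\<^sub>R Y \<in> U" if "0 \<le> s" "s \<le> h" "0 \<le> t" "t \<le> h" for s t
      using r(2)[OF near[OF that]] by simp
  qed
  have near': "w + s *\<^sub>R Y + t *\<^sub>R X \<in> U" if "0 \<le> s" "s \<le> h" "0 \<le> t" "t \<le> h" for s t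
    using r near[of t s] that by (simp add: algebra_simps)
  obtain c d where cd: "0 < c" "c < h" "0 < d" "d < h"
    "f (w + h *\<^sub>R Y + h *\<^sub>R X) - f (w + h *\<^sub>R Y) - f (w + h *\<^sub>R X) + f w = h * h * ?Q (w + c *\<^sub>R Y + d *\<^sub>R X)"
    by (rule second_difference[OF assms(3) \<open>h > 0\<close>, of w Y X, OF near'])
  have "?P (w + a *\<^sub>R X + b *\<^sub>R Y) = ?Q (w + d *\<^sub>R X + c *\<^sub>R Y)"
    using ab(5) cd(5) \<open>h > 0\<close> by (simp add: algebra_simps)
  moreover have "dist (?P (w + a *\<^sub>R X + b *\<^sub>R Y)) (?P w) < e" "dist (?Q (w + d *\<^sub>R X + c *\<^sub>R Y)) (?Q w) < e"
    using r near ab cd by auto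
  ultimately have "dist (?P w) (?Q w) < e + e"
    using dist_triangle3[of "?P w" "?Q w" "?P (w + a *\<^sub>R X + b *\<^sub>R Y)"] by simp
  then show False by (simp add: dist_real_def e_def)
qed

lemma ddir_component:
  fixes f :: "'a::real_normed_vector \<Rightarrow> real ^ 'n"
  assumes "f differentiable (at w)"
  shows "ddir (\<lambda>y. f y $ i) X w = ddir f X w $ i"
  by (rule ddir_linear[OF bounded_linear_vec_nth assms])

text \<open>The mean value theorem is a scalar statement, hence the reduction to components.\<close>

lemma ddir_commute:
  fixes f :: "'a::real_normed_vector \<Rightarrow> real ^ 'n"
  assumes "open U" "w \<in> U" "smooth_on U f"
  shows "ddir (ddir f X) Y w = ddir (ddir f Y) X w"
proof -
  have "ddir (ddir f X) Y w $ i = ddir (ddir (\<lambda>y. f y $ i) X) Y w" for X Y i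
  proof -
    have "ddir (ddir (\<lambda>y. f y $ i) X) Y w = ddir (\<lambda>y. ddir f X y $ i) Y w"
      using assms by (intro ddir_cong_open ddir_component) (auto intro: smooth_on_differentiable)
    also have "\<dots> = ddir (ddir f X) Y w $ i"
      using assms by (intro ddir_component) (auto intro: smooth_on_differentiable smooth_on_ddir)
    finally show ?thesis by simp
  qed
  moreover have "Ck_on 2 U (\<lambda>y. f y $ i)" for i
    using smooth_on_linear[OF assms(1) bounded_linear_vec_nth assms(3)] by (simp add: smooth_on_def)
  ultimately show ?thesis
    using ddir_commute_real[OF assms(1,2)] by (simp add: vec_eq_iff)
qed

section \<open>Bilinear algebra of the metric\<close>

lemma mink_commute: "mink x y = mink y x"
  by (simp add: mink_def mult.commute)

lemma mink_add_left: "mink (x + y) z = mink x z + mink y z"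
  by (simp add: mink_def sum.distrib algebra_simps)

lemma mink_diff_left: "mink (x - y) z = mink x z - mink y z"
  by (simp add: mink_def sum_subtractf algebra_simps)

lemma mink_minus_left: "mink (- x) z = - mink x z"
  by (simp add: mink_def sum_negf)

lemma mink_scale_left: "mink (c *s x) z = c * mink x z"
  by (simp add: mink_def sum_distrib_left algebra_simps)

lemma mink_zero_left: "mink 0 z = 0"
  by (simp add: mink_def)

lemma mink_add_right: "mink z (x + y) = mink z x + mink z y"
  and mink_diff_right: "mink z (x - y) = mink z x - mink z y"
  and mink_minus_right: "mink z (- x) = - mink z x"
  and mink_scale_right: "mink z (c *s x) = c * mink z x"
  and mink_zero_right: "mink z 0 = 0"
  by (simp_all add: mink_commute[of z] mink_add_left mink_diff_left mink_minus_left mink_scale_left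
      mink_zero_left)

lemmas mink_linear = mink_add_left mink_diff_left mink_minus_left mink_scale_left mink_zero_left
  mink_add_right mink_diff_right mink_minus_right mink_scale_right mink_zero_right

lemma mink_scaleR_left: "mink (r *\<^sub>R x) (y :: real ^ 5) = r * mink x y"
  using mink_scale_left[of r x y] by (simp add: scalar_mult_eq_scaleR)

lemma mink_scaleR_right: "mink y (r *\<^sub>R x :: real ^ 5) = r * mink y x"
  using mink_scale_right[of y r x] by (simp add: scalar_mult_eq_scaleR)

lemma mink_axis: "mink v (axis i 1) = (if i = 0 then - v $ 0 else v $ i)"
  by (simp add: mink_def axis_def sum.If_cases if_distrib cong: if_cong)

lemma mink_nondegenerate:
  assumes "\<And>w. mink v w = 0"
  shows "v = 0"
proof -
  have "v $ i = 0" for i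
    using assms[of "axis i 1"] by (simp add: mink_axis split: if_splits)
  then show ?thesis by (simp add: vec_eq_iff)
qed

lemma bounded_bilinear_mink_real: "bounded_bilinear (mink :: real ^ 5 \<Rightarrow> _)"
  unfolding bilinear_conv_bounded_bilinear[symmetric]
  by (auto simp: bilinear_def linear_iff mink_linear mink_scaleR_left mink_scaleR_right)

lemma scaleR_eq_of_real_scale: "r *\<^sub>R x = complex_of_real r *s (x :: complex ^ 'n)"
  by (simp add: vec_eq_iff scaleR_conv_of_real[where 'a = complex])

lemma bounded_bilinear_mink_complex: "bounded_bilinear (mink :: complex ^ 5 \<Rightarrow> _)"
  unfolding bilinear_conv_bounded_bilinear[symmetric]
  by (auto simp: bilinear_def linear_iff mink_linear scaleR_eq_of_real_scale scaleR_conv_of_real)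

lemma bounded_bilinear_scale: "bounded_bilinear ((*s) :: complex \<Rightarrow> complex ^ 'n \<Rightarrow> _)"
  unfolding bilinear_conv_bounded_bilinear[symmetric]
  by (auto simp: bilinear_def linear_iff vec_eq_iff algebra_simps)

lemma cvec_add: "cvec (x + y) = cvec x + cvec y"
  and cvec_diff: "cvec (x - y) = cvec x - cvec y"
  and cvec_scaleR: "cvec (r *\<^sub>R x) = complex_of_real r *s cvec x"
  and cvec_minus: "cvec (- x) = - cvec x"
  and cvec_zero: "cvec 0 = 0"
  by (simp_all add: cvec_def vec_eq_iff)

lemmas cvec_linear = cvec_add cvec_diff cvec_scaleR cvec_minus cvec_zero

lemma cvec_eq_iff: "cvec x = cvec y \<longleftrightarrow> x = y"
  by (simp add: cvec_def vec_eq_iff)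

lemma bounded_linear_cvec: "bounded_linear cvec"
  by (auto simp: linear_conv_bounded_linear[symmetric] linear_iff cvec_linear scaleR_eq_of_real_scale)

lemma mink_cvec: "mink (cvec x) (cvec y) = complex_of_real (mink x y)"
  by (simp add: mink_def cvec_def)

lemma cnj_vec_cvec: "cnj_vec (cvec x) = cvec x"
  by (simp add: cnj_vec_def cvec_def vec_eq_iff)

lemma mink_cnj_vec: "mink (cnj_vec x) (cnj_vec y) = cnj (mink x y)"
  by (simp add: mink_def cnj_vec_def)

lemma cnj_vec_diff: "cnj_vec (x - y) = cnj_vec x - cnj_vec y"
  and cnj_vec_scale: "cnj_vec (c *s x) = cnj c *s cnj_vec x"
  by (simp_all add: cnj_vec_def vec_eq_iff)

section \<open>Orthogonal splitting along a unit vector, over the reals and the complex numbers at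
  once\<close>

lemma mem_orth_singleton: "v \<in> orth {n} \<longleftrightarrow> mink v n = 0"
  by (simp add: orth_def)

text \<open>Removing its \<open>n\<close>-component moves any \<open>y\<close> into
  \<open>orth {n}\<close>; pairing \<open>v\<close> with the result shows that
  \<open>v - mink v n *s n\<close> is orthogonal to every \<open>y\<close>, and nondegeneracy
  finishes.\<close>

lemma mem_orth_orth_unit:
  assumes "mink n n = 1"
  shows "v \<in> orth (orth {n}) \<longleftrightarrow> v = mink v n *s n"
proof
  assume v: "v \<in> orth (orth {n})"
  have "mink (v - mink v n *s n) y = 0" for y
  proof -
    have "y - mink y n *s n \<in> orth {n}"
      by (simp add: mem_orth_singleton mink_linear assms)
    with v have "mink v (y - mink y n *s n) = 0" by (auto simp: orth_def)
    then show ?thesis by (simp add: mink_linear mink_commute[of n] mult.commute)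
  qed
  then have "v - mink v n *s n = 0" by (rule mink_nondegenerate)
  then show "v = mink v n *s n" by simp
next
  assume v: "v = mink v n *s n"
  show "v \<in> orth (orth {n})"
    unfolding orth_def[of "orth {n}"]
    by (subst v) (auto simp: mem_orth_singleton mink_linear mink_commute[of n])
qed

lemma proj_orth_unit:
  assumes "mink n n = 1"
  shows "proj (orth {n}) v = v - mink v n *s n"
  unfolding proj_def
proof (rule the_equality)
  show "v - mink v n *s n \<in> orth {n} \<and> v - (v - mink v n *s n) \<in> orth (orth {n})"
    by (simp add: mem_orth_singleton mem_orth_orth_unit[OF assms] mink_linear assms)
next
  fix u assume u: "u \<in> orth {n} \<and> v - u \<in> orth (orth {n})"
  then have "v - u = mink (v - u) n *s n" using mem_orth_orth_unit[OF assms] by blast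
  with u show "u = v - mink v n *s n" by (simp add: mem_orth_singleton mink_linear algebra_simps)
qed

lemma proj_orth_orth_unit:
  assumes "mink n n = 1"
  shows "proj (orth (orth {n})) v = mink v n *s n"
  unfolding proj_def
proof (rule the_equality)
  show "mink v n *s n \<in> orth (orth {n}) \<and> v - mink v n *s n \<in> orth (orth (orth {n}))"
    unfolding orth_def[of "orth (orth {n})"]
    by (auto simp: mem_orth_orth_unit[OF assms] mink_linear assms)
       (metis diff_self assms mem_orth_orth_unit mink_linear mult.commute mult.right_neutral)
next
  fix u assume u: "u \<in> orth (orth {n}) \<and> v - u \<in> orth (orth (orth {n}))"
  then have un: "u = mink u n *s n" using mem_orth_orth_unit[OF assms] by blast
  have "n \<in> orth (orth {n})" by (simp add: mem_orth_orth_unit[OF assms] assms)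
  with u have "mink (v - u) n = 0" unfolding orth_def[of "orth (orth {n})"] by blast
  with un show "u = mink v n *s n" by (simp add: mink_linear)
qed

lemma UNIV_5: "(UNIV :: 5 set) = {0, 1, 2, 3, 4}"
proof -
  have "card {0, 1, 2, 3, 4 :: 5} = CARD(5)" by simp
  then show ?thesis by (intro card_subset_eq[symmetric]) auto
qed

text \<open>Pairing with the frame shows that the coordinate map is injective; it is onto by dimension.\<close>

lemma frame_expand:
  fixes s x y l n v :: "'a::field ^ 5"
  assumes gram: "mink s s = 0" "mink s x = 0" "mink s y = 0" "mink s l = \<mu>" "mink s n = 0"
    "mink x x = \<rho>" "mink x y = 0" "mink y y = \<rho>" "mink x n = 0" "mink y n = 0" "mink l n = 0"
    "mink n n = 1" and nz: "\<mu> \<noteq> 0" "\<rho> \<noteq> 0"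
  obtains a b c d e where "v = a *s s + b *s x + c *s y + d *s l + e *s n"
proof -
  define F :: "'a ^ 5 \<Rightarrow> 'a ^ 5" where
    "F t = t $ 0 *s s + t $ 1 *s x + t $ 2 *s y + t $ 3 *s l + t $ 4 *s n" for t
  have lin: "Vector_Spaces.linear (*s) (*s) F"
    by unfold_locales (simp_all add: F_def vec_eq_iff algebra_simps)
  have gram_sym: "mink x s = 0" "mink y s = 0" "mink l s = \<mu>" "mink n s = 0" "mink y x = 0"
    "mink n x = 0" "mink n y = 0" "mink n l = 0"
    using gram mink_commute[of x s] mink_commute[of y s] mink_commute[of l s] mink_commute[of n s]
      mink_commute[of y x] mink_commute[of n x] mink_commute[of n y] mink_commute[of n l] by simp_all
  have "t = 0" if "F t = 0" for t
  proof -
    have p: "mink (F t) z = 0" for z using that by (simp add: mink_linear)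
    \<comment> \<open>The order of elimination matters: \<open>s\<close> meets only
      \<open>l\<close>, and \<open>n\<close> meets only \<open>n\<close>. The products of
      \<open>l\<close> with \<open>x\<close>, \<open>y\<close> and itself are unknown, so
      \<open>l\<close> is paired last, when only the coefficient of \<open>s\<close> is
      left.\<close>
    have 3: "t $ 3 = 0"
      using p[of s] nz by (simp add: F_def mink_linear gram gram_sym)
    have 4: "t $ 4 = 0"
      using p[of n] by (simp add: F_def mink_linear gram gram_sym)
    have 1: "t $ 1 = 0"
      using p[of x] nz 3 4 by (simp add: F_def mink_linear gram gram_sym)
    have 2: "t $ 2 = 0"
      using p[of y] nz 3 4 by (simp add: F_def mink_linear gram gram_sym)
    have 0: "t $ 0 = 0"
      using p[of l] nz 1 2 3 4 by (simp add: F_def mink_linear gram gram_sym)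
    have "t $ i = 0" for i
    proof -
      have "i \<in> {0, 1, 2, 3, 4}" by (simp only: UNIV_5[symmetric] UNIV_I)
      with 0 1 2 3 4 show ?thesis by auto
    qed
    then show "t = 0" by (simp add: vec_eq_iff)
  qed
  then have "inj F" using vec.linear_inj_iff_eq_0[OF lin] by blast
  then have "surj F" by (rule vec.linear_injective_imp_surjective[OF lin _ refl])
  then obtain t where "v = F t" by auto
  then show ?thesis using that unfolding F_def by blast
qed

section \<open>The real structure equations\<close>

lemma ddir_mink:
  fixes f g :: "complex \<Rightarrow> real ^ 5"
  assumes "f differentiable (at w)" "g differentiable (at w)"
  shows "ddir (\<lambda>y. mink (f y) (g y)) X w = mink (f w) (ddir g X w) + mink (ddir f X w) (g w)"
  by (rule ddir_bilinear[OF bounded_bilinear_mink_real assms])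

lemma ddir_mink_const:
  fixes f g :: "complex \<Rightarrow> real ^ 5"
  assumes "open U" "w \<in> U" "smooth_on U f" "smooth_on U g"
    and "\<And>y. y \<in> U \<Longrightarrow> mink (f y) (g y) = k"
  shows "mink (ddir f X w) (g w) = - mink (f w) (ddir g X w)"
proof -
  have "ddir (\<lambda>y. mink (f y) (g y)) X w = ddir (\<lambda>_. k) X w"
    by (rule ddir_cong_open[OF assms(1,2,5)])
  then show ?thesis
    using assms by (simp add: ddir_mink smooth_on_differentiable)
qed

lemma ddir_mink_eq:
  fixes f g f' g' :: "complex \<Rightarrow> real ^ 5"
  assumes "open U" "w \<in> U" "smooth_on U f" "smooth_on U g" "smooth_on U f'" "smooth_on U g'"
    and "\<And>y. y \<in> U \<Longrightarrow> mink (f y) (g y) = mink (f' y) (g' y)"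
  shows "mink (f w) (ddir g X w) + mink (ddir f X w) (g w) =
    mink (f' w) (ddir g' X w) + mink (ddir f' X w) (g' w)"
proof -
  have "ddir (\<lambda>y. mink (f y) (g y)) X w = ddir (\<lambda>y. mink (f' y) (g' y)) X w"
    by (rule ddir_cong_open[OF assms(1,2,7)])
  then show ?thesis
    using assms by (simp add: ddir_mink smooth_on_differentiable)
qed

lemma ddir_complex_expand:
  assumes "f differentiable (at w)"
  shows "ddir f X w = Re X *\<^sub>R ddir f 1 w + Im X *\<^sub>R ddir f \<i> w"
proof -
  have "X = Re X *\<^sub>R 1 + Im X *\<^sub>R \<i>" by (simp add: complex_eq_iff)
  then have "ddir f X w = ddir f (Re X *\<^sub>R 1 + Im X *\<^sub>R \<i>) w" by simp
  also have "\<dots> = Re X *\<^sub>R ddir f 1 w + Im X *\<^sub>R ddir f \<i> w"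
    by (simp only: linear_add[OF linear_ddir[OF assms]] linear_scale[OF linear_ddir[OF assms]])
  finally show ?thesis .
qed

text \<open>In a holomorphic chart \<open>s\<close> is a lift of the surface; the last three assumptions say that \<open>n\<close>
  is orthogonal to the central sphere congruence.\<close>

locale conformal_lift =
  fixes U :: "complex set" and s n :: "complex \<Rightarrow> real ^ 5"
  assumes open_U: "open U" and smooth_s: "smooth_on U s" and smooth_n: "smooth_on U n"
    and ss: "w \<in> U \<Longrightarrow> mink (s w) (s w) = 0"
    and nn: "w \<in> U \<Longrightarrow> mink (n w) (n w) = 1"
    and conformal: "w \<in> U \<Longrightarrow> \<exists>\<rho>>0. \<forall>X Y. mink (ddir s X w) (ddir s Y w) = \<rho> * (X \<bullet> Y)"
    and sn: "w \<in> U \<Longrightarrow> mink (s w) (n w) = 0"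
    and dsn: "w \<in> U \<Longrightarrow> mink (ddir s X w) (n w) = 0"
    and lap_sn: "w \<in> U \<Longrightarrow> mink (ddir (ddir s 1) 1 w + ddir (ddir s \<i>) \<i> w) (n w) = 0"
begin

abbreviation "lap f w \<equiv> ddir (ddir f 1) 1 w + ddir (ddir f \<i>) \<i> w"

lemma smooth_ds: "smooth_on U (ddir s X)" and smooth_dn: "smooth_on U (ddir n X)"
  using smooth_s smooth_n by (auto intro: smooth_on_ddir)

lemma diff_s: "w \<in> U \<Longrightarrow> s differentiable (at w)"
  and diff_n: "w \<in> U \<Longrightarrow> n differentiable (at w)"
  and diff_ds: "w \<in> U \<Longrightarrow> ddir s X differentiable (at w)"
  and diff_dn: "w \<in> U \<Longrightarrow> ddir n X differentiable (at w)"
  using smooth_s smooth_n smooth_ds smooth_dn by (auto intro: smooth_on_differentiable)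

lemmas symm_s = ddir_commute[OF open_U _ smooth_s]
lemmas symm_n = ddir_commute[OF open_U _ smooth_n]

lemma sds: "w \<in> U \<Longrightarrow> mink (s w) (ddir s X w) = 0"
  using ddir_mink_const[OF open_U _ smooth_s smooth_s ss, of w X] by (simp add: mink_commute)

lemma ndn: "w \<in> U \<Longrightarrow> mink (n w) (ddir n X w) = 0"
  using ddir_mink_const[OF open_U _ smooth_n smooth_n nn, of w X] by (simp add: mink_commute)

lemma sdn: "w \<in> U \<Longrightarrow> mink (s w) (ddir n X w) = 0"
  using ddir_mink_const[OF open_U _ smooth_s smooth_n sn, of w X] dsn[of w X] by simp

lemma sdds: "w \<in> U \<Longrightarrow> mink (s w) (ddir (ddir s X) Y w) = - mink (ddir s X w) (ddir s Y w)"
  using ddir_mink_const[OF open_U _ smooth_s smooth_ds sds, of w Y] by (simp add: mink_commute)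

lemma ddsn: "w \<in> U \<Longrightarrow> mink (ddir (ddir s X) Y w) (n w) = - mink (ddir s X w) (ddir n Y w)"
  by (rule ddir_mink_const[OF open_U _ smooth_ds smooth_n dsn])

text \<open>By \<open>ddsn\<close> both equations concern the normal component of the Hessian of
  \<open>s\<close>: its symmetry gives the first, and \<open>lap_sn\<close> makes it trace-free,
  which gives the second.\<close>

lemma second_fundamental_form:
  assumes "w \<in> U"
  shows "mink (ddir s \<i> w) (ddir n 1 w) = mink (ddir s 1 w) (ddir n \<i> w)"
    and "mink (ddir s 1 w) (ddir n 1 w) = - mink (ddir s \<i> w) (ddir n \<i> w)"
  using ddsn[OF assms, of 1 \<i>] ddsn[OF assms, of \<i> 1] symm_s[OF assms, of 1 \<i>]
    ddsn[OF assms, of 1 1] ddsn[OF assms, of \<i> \<i>] lap_sn[OF assms]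
  by (simp_all add: mink_linear)

text \<open>The value \<open>-2 \<rho>\<close> comes from differentiating
  \<open>mink s (ddir s X) = 0\<close> once more: each of the two pure second derivatives
  contributes \<open>-\<rho>\<close>.\<close>

lemma frame:
  assumes "w \<in> U"
  obtains \<rho> where "\<rho> > 0" "mink (ddir s 1 w) (ddir s 1 w) = \<rho>" "mink (ddir s \<i> w) (ddir s \<i> w) = \<rho>"
    "mink (ddir s 1 w) (ddir s \<i> w) = 0" "mink (s w) (lap s w) = - 2 * \<rho>"
proof -
  obtain \<rho> where \<rho>: "\<rho> > 0" "\<And>X Y. mink (ddir s X w) (ddir s Y w) = \<rho> * (X \<bullet> Y)"
    using conformal[OF assms] by blast
  show ?thesis
    by (rule that[of \<rho>]) (use \<rho> sdds[OF assms] in \<open>auto simp: inner_complex_def mink_linear\<close>)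
qed

lemma frame_expand_real:
  assumes "w \<in> U"
  obtains a b c d e where "v = a *\<^sub>R s w + b *\<^sub>R ddir s 1 w + c *\<^sub>R ddir s \<i> w + d *\<^sub>R lap s w + e *\<^sub>R n w"
proof -
  obtain \<rho> where \<rho>: "\<rho> > 0" "mink (ddir s 1 w) (ddir s 1 w) = \<rho>" "mink (ddir s \<i> w) (ddir s \<i> w) = \<rho>"
    "mink (ddir s 1 w) (ddir s \<i> w) = 0" "mink (s w) (lap s w) = - 2 * \<rho>"
    using frame[OF assms] .
  have "- 2 * \<rho> \<noteq> 0" "\<rho> \<noteq> 0" using \<rho>(1) by auto
  obtain a b c d e where "v = a *s s w + b *s ddir s 1 w + c *s ddir s \<i> w + d *s lap s w + e *s n w"
    using frame_expand[OF ss[OF assms] sds[OF assms] sds[OF assms] \<rho>(5) sn[OF assms] \<rho>(2) \<rho>(4) \<rho>(3)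
      dsn[OF assms] dsn[OF assms] lap_sn[OF assms] nn[OF assms] \<open>- 2 * \<rho> \<noteq> 0\<close> \<open>\<rho> \<noteq> 0\<close>, of v] .
  then show ?thesis by (intro that) (simp only: scalar_mult_eq_scaleR)
qed

lemma frame_expand_complex:
  assumes "w \<in> U"
  obtains a b c d e where "v = a *s cvec (s w) + b *s cvec (ddir s 1 w) + c *s cvec (ddir s \<i> w)
    + d *s cvec (lap s w) + e *s cvec (n w)"
proof -
  obtain \<rho> where \<rho>: "\<rho> > 0" "mink (ddir s 1 w) (ddir s 1 w) = \<rho>" "mink (ddir s \<i> w) (ddir s \<i> w) = \<rho>"
    "mink (ddir s 1 w) (ddir s \<i> w) = 0" "mink (s w) (lap s w) = - 2 * \<rho>"
    using frame[OF assms] .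
  have nz: "complex_of_real (- 2 * \<rho>) \<noteq> 0" "complex_of_real \<rho> \<noteq> 0" using \<rho>(1) by auto
  have gram: "mink (cvec (s w)) (cvec (s w)) = 0" "mink (cvec (s w)) (cvec (ddir s 1 w)) = 0"
    "mink (cvec (s w)) (cvec (ddir s \<i> w)) = 0"
    "mink (cvec (s w)) (cvec (lap s w)) = complex_of_real (- 2 * \<rho>)"
    "mink (cvec (s w)) (cvec (n w)) = 0"
    "mink (cvec (ddir s 1 w)) (cvec (ddir s 1 w)) = complex_of_real \<rho>"
    "mink (cvec (ddir s 1 w)) (cvec (ddir s \<i> w)) = 0"
    "mink (cvec (ddir s \<i> w)) (cvec (ddir s \<i> w)) = complex_of_real \<rho>"
    "mink (cvec (ddir s 1 w)) (cvec (n w)) = 0" "mink (cvec (ddir s \<i> w)) (cvec (n w)) = 0"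
    "mink (cvec (lap s w)) (cvec (n w)) = 0" "mink (cvec (n w)) (cvec (n w)) = 1"
    unfolding mink_cvec \<rho> ss[OF assms] sds[OF assms] sn[OF assms] dsn[OF assms] lap_sn[OF assms] nn[OF assms]
    by simp_all
  show ?thesis using frame_expand[OF gram nz, of v] that .
qed

text \<open>Within the frame \<open>n\<close> pairs only with itself, and \<open>s\<close> only with
  \<open>lap s\<close>; as \<open>ddir n X\<close> is orthogonal to both \<open>n\<close> and
  \<open>s\<close>, these two coefficients vanish. This is what later puts \<open>q_inf\<close> into
  \<Lambda> wedge \<open>Lambda1\<close>.\<close>

lemma dn_tangent:
  assumes "w \<in> U"
  obtains a b c where "ddir n X w = a *\<^sub>R s w + b *\<^sub>R ddir s 1 w + c *\<^sub>R ddir s \<i> w"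
proof -
  obtain a b c d e where v: "ddir n X w = a *\<^sub>R s w + b *\<^sub>R ddir s 1 w + c *\<^sub>R ddir s \<i> w + d *\<^sub>R lap s w + e *\<^sub>R n w"
    using frame_expand_real[OF assms] .
  obtain \<rho> where \<rho>: "\<rho> > 0" "mink (s w) (lap s w) = - 2 * \<rho>"
    using frame[OF assms] .
  have "mink (n w) (ddir n X w) = e"
    unfolding v using sn[OF assms] dsn[OF assms] lap_sn[OF assms] nn[OF assms]
    by (simp add: mink_add_right mink_scaleR_right mink_commute)
  moreover have "mink (s w) (ddir n X w) = d * (- 2 * \<rho>)"
    unfolding v using ss[OF assms] sds[OF assms] sn[OF assms] \<rho>(2)
    by (simp only: mink_add_right[of "s w" _ "e *\<^sub>R n w"] mink_add_right[of "s w" _ "d *\<^sub>R lap s w"]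
        mink_add_right[of "s w" _ "c *\<^sub>R ddir s \<i> w"] mink_add_right[of "s w" _ "b *\<^sub>R ddir s 1 w"]
        mink_scaleR_right)
  ultimately have "e = 0" "d = 0" using ndn[OF assms] sdn[OF assms] \<rho>(1) by auto
  with v that show ?thesis by simp
qed

end

text \<open>Here \<open>c\<close> is the vector \<open>v\<^sub>\<infinity>\<close> and \<open>s\<close> the lift \<open>\<sigma>\<^sub>\<infinity>\<close>.\<close>

locale cmc_lift = conformal_lift +
  fixes c :: "real ^ 5" and h :: real
  assumes sc: "w \<in> U \<Longrightarrow> mink (s w) c = - 1"
    and nc: "w \<in> U \<Longrightarrow> mink (n w) c = h"
begin

lemma dsc: "w \<in> U \<Longrightarrow> mink (ddir s X w) c = 0"
  using ddir_mink_const[OF open_U _ smooth_s smooth_on_const sc, of w X] by (simp add: mink_linear)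

lemma dnc: "w \<in> U \<Longrightarrow> mink (ddir n X w) c = 0"
  using ddir_mink_const[OF open_U _ smooth_n smooth_on_const nc, of w X] by (simp add: mink_linear)

lemma ddnc: "w \<in> U \<Longrightarrow> mink (ddir (ddir n X) Y w) c = 0"
  using ddir_mink_const[OF open_U _ smooth_dn smooth_on_const dnc, of w X Y] by (simp add: mink_linear)

text \<open>Pairing with \<open>c\<close> removes the component of \<open>d n\<close> along \<open>s\<close>.\<close>

lemma shape_operator:
  assumes "w \<in> U"
  obtains a b where "ddir n 1 w = a *\<^sub>R ddir s 1 w + b *\<^sub>R ddir s \<i> w"
    "ddir n \<i> w = b *\<^sub>R ddir s 1 w - a *\<^sub>R ddir s \<i> w"
proof -
  have *: "\<exists>b c. ddir n X w = b *\<^sub>R ddir s 1 w + c *\<^sub>R ddir s \<i> w" for X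
  proof -
    obtain a b d where v: "ddir n X w = a *\<^sub>R s w + b *\<^sub>R ddir s 1 w + d *\<^sub>R ddir s \<i> w"
      using dn_tangent[OF assms] .
    have "mink (ddir n X w) c = - a"
      unfolding v by (simp add: mink_linear mink_scaleR_left sc[OF assms] dsc[OF assms])
    then have "a = 0" using dnc[OF assms, of X] by linarith
    with v show ?thesis by auto
  qed
  obtain a b where 1: "ddir n 1 w = a *\<^sub>R ddir s 1 w + b *\<^sub>R ddir s \<i> w" using * by blast
  obtain p q where 2: "ddir n \<i> w = p *\<^sub>R ddir s 1 w + q *\<^sub>R ddir s \<i> w" using * by blast
  obtain \<rho> where \<rho>: "\<rho> > 0" "mink (ddir s 1 w) (ddir s 1 w) = \<rho>" "mink (ddir s \<i> w) (ddir s \<i> w) = \<rho>"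
    "mink (ddir s 1 w) (ddir s \<i> w) = 0" using frame[OF assms] .
  have 3: "mink (ddir s \<i> w) (ddir s 1 w) = 0" using \<rho>(4) by (simp add: mink_commute)
  \<comment> \<open>Symmetry and trace-freeness of the second fundamental form, read as relations
    between the four coefficients.\<close>
  have "b * \<rho> = p * \<rho>" "a * \<rho> = - q * \<rho>"
    using second_fundamental_form[OF assms] unfolding 1 2
    by (simp_all add: mink_linear mink_scaleR_right \<rho>(2-4) 3)
  then have "p = b" "q = - a" using \<rho>(1) mult_right_cancel[of \<rho> a "- q"] by simp_all
  show ?thesis
    by (rule that[OF 1]) (simp add: 2 \<open>p = b\<close> \<open>q = - a\<close>)
qed

text \<open>The Codazzi equation. Adding the derivatives of the trace and symmetry relations of the
  second fundamental form gives, with subscripts for derivatives,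
  \<open>(s_x, lap n) = -(s_xx - s_yy, n_x) - 2 (s_xy, n_y)\<close>, and similarly for
  \<open>s_y\<close>. The right side vanishes for a symmetric trace-free shape operator in a
  conformal chart.\<close>

lemma lap_n_tangent:
  assumes "w \<in> U"
  shows "mink (ddir s 1 w) (lap n w) = 0" "mink (ddir s \<i> w) (lap n w) = 0"
proof -
  note m = open_U assms
  let ?sx = "ddir s 1" and ?sy = "ddir s \<i>" and ?nx = "ddir n 1" and ?ny = "ddir n \<i>"
  let ?sxx = "ddir ?sx 1 w" and ?sxy = "ddir ?sx \<i> w" and ?syy = "ddir ?sy \<i> w"
  let ?nxx = "ddir ?nx 1 w" and ?nxy = "ddir ?nx \<i> w" and ?nyy = "ddir ?ny \<i> w"
  have sxy: "ddir ?sy 1 w = ?sxy" and nxy: "ddir ?ny 1 w = ?nxy"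
    using symm_s[OF assms] symm_n[OF assms] by auto
  have c1: "mink (?sx y) (?sx y) = mink (?sy y) (?sy y)" and c2: "mink (?sx y) (?sy y) = 0" if "y \<in> U" for y
    using frame[OF that] by metis+
  \<comment> \<open>Differentiated conformality: these four relations express all tangential parts
    of the Hessian of \<open>s\<close> through those of \<open>?sxy\<close>.\<close>
  have "mink (?sx w) ?sxx = mink (?sy w) ?sxy" "mink (?sx w) ?sxy = mink (?sy w) ?syy"
    using ddir_mink_eq[OF m smooth_ds smooth_ds smooth_ds smooth_ds c1, of 1]
      ddir_mink_eq[OF m smooth_ds smooth_ds smooth_ds smooth_ds c1, of \<i>]
    by (simp_all add: sxy mink_commute)
  moreover have "mink (?sy w) ?sxx = - mink (?sx w) ?sxy" "mink (?sy w) ?sxy = - mink (?sx w) ?syy"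
    using ddir_mink_const[OF m smooth_ds smooth_ds c2, of 1] ddir_mink_const[OF m smooth_ds smooth_ds c2, of \<i>]
    by (simp_all add: sxy mink_commute)
  moreover obtain a b where ab: "?nx w = a *\<^sub>R ?sx w + b *\<^sub>R ?sy w" "?ny w = b *\<^sub>R ?sx w - a *\<^sub>R ?sy w"
    using shape_operator[OF assms] .
  \<comment> \<open>Derivative of the trace-free condition.\<close>
  have "mink (?sx w) (ddir ?nx X w) + mink (ddir ?sx X w) (?nx w)
      + (mink (?sy w) (ddir ?ny X w) + mink (ddir ?sy X w) (?ny w)) = 0" for X
  proof -
    have "ddir (\<lambda>y. mink (?sx y) (?nx y) + mink (?sy y) (?ny y)) X w = ddir (\<lambda>_. 0) X w"
      by (rule ddir_cong_open[OF m]) (simp add: second_fundamental_form)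
    moreover have "(\<lambda>y. mink (?sx y) (?nx y)) differentiable (at w)"
      "(\<lambda>y. mink (?sy y) (?ny y)) differentiable (at w)"
      by (simp_all add: differentiable_bilinear[OF bounded_bilinear_mink_real] diff_ds[OF assms] diff_dn[OF assms])
    ultimately show ?thesis
      by (simp add: ddir_add ddir_mink[OF diff_ds[OF assms] diff_dn[OF assms]])
  qed
  from this[of 1] this[of \<i>]
  have "mink (?sx w) ?nxx + mink ?sxx (?nx w) + (mink (?sy w) ?nxy + mink ?sxy (?ny w)) = 0"
    "mink (?sx w) ?nxy + mink ?sxy (?nx w) + (mink (?sy w) ?nyy + mink ?syy (?ny w)) = 0"
    by (simp_all only: sxy nxy)
  \<comment> \<open>Derivative of the symmetry condition; it trades the mixed derivative of
    \<open>n\<close> for the pure one still missing in the Laplacian.\<close>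
  moreover have "mink (?sy w) ?nxx + mink ?sxy (?nx w) = mink (?sx w) ?nxy + mink ?sxx (?ny w)"
    "mink (?sy w) ?nxy + mink ?syy (?nx w) = mink (?sx w) ?nyy + mink ?sxy (?ny w)"
    using ddir_mink_eq[OF m smooth_ds smooth_dn smooth_ds smooth_dn second_fundamental_form(1), of 1]
      ddir_mink_eq[OF m smooth_ds smooth_dn smooth_ds smooth_dn second_fundamental_form(1), of \<i>]
    by (simp_all only: sxy nxy)
  ultimately show "mink (ddir s 1 w) (lap n w) = 0" "mink (ddir s \<i> w) (lap n w) = 0"
    unfolding ab mink_linear mink_scaleR_left mink_scaleR_right
      mink_commute[of ?sxx "?sx w"] mink_commute[of ?sxy "?sx w"] mink_commute[of ?syy "?sx w"]
      mink_commute[of ?sxx "?sy w"] mink_commute[of ?sxy "?sy w"] mink_commute[of ?syy "?sy w"]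
    by algebra+
qed

text \<open>The component along \<open>n\<close> is \<open>-\<bar>dn\<bar>\<^sup>2\<close>, and pairing with \<open>c\<close> gives the one along \<open>s\<close>.\<close>

lemma laplace_n:
  assumes "w \<in> U"
  shows "lap n w = - (mink (ddir n 1 w) (ddir n 1 w) + mink (ddir n \<i> w) (ddir n \<i> w)) *\<^sub>R (n w + h *\<^sub>R s w)"
proof -
  let ?k = "mink (ddir n 1 w) (ddir n 1 w) + mink (ddir n \<i> w) (ddir n \<i> w)"
  obtain a b p d e where v: "lap n w = a *\<^sub>R s w + b *\<^sub>R ddir s 1 w + p *\<^sub>R ddir s \<i> w + d *\<^sub>R lap s w + e *\<^sub>R n w"
    using frame_expand_real[OF assms] .
  obtain \<rho> where \<rho>: "\<rho> > 0" "mink (ddir s 1 w) (ddir s 1 w) = \<rho>" "mink (ddir s \<i> w) (ddir s \<i> w) = \<rho>"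
    "mink (ddir s 1 w) (ddir s \<i> w) = 0" "mink (s w) (lap s w) = - 2 * \<rho>" using frame[OF assms] .
  have sddn: "mink (s w) (ddir (ddir n X) X w) = - mink (ddir s X w) (ddir n X w)"
    and nddn: "mink (n w) (ddir (ddir n X) X w) = - mink (ddir n X w) (ddir n X w)" for X
    using ddir_mink_const[OF open_U assms smooth_s smooth_dn sdn, of X]
      ddir_mink_const[OF open_U assms smooth_n smooth_dn ndn, of X] by simp_all
  \<comment> \<open>The product is minus the trace of the second fundamental form.\<close>
  have "mink (s w) (lap n w) = 0"
    using second_fundamental_form(2)[OF assms] by (simp add: mink_add_right sddn)
  moreover have "mink (s w) (lap n w) = d * (- 2 * \<rho>)"
    unfolding v mink_add_right[of "s w" _ "e *\<^sub>R n w"] mink_add_right[of "s w" _ "d *\<^sub>R lap s w"]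
      mink_add_right[of "s w" _ "p *\<^sub>R ddir s \<i> w"] mink_add_right[of "s w" _ "b *\<^sub>R ddir s 1 w"]
      mink_scaleR_right \<rho>(5)
    by (simp add: ss[OF assms] sds[OF assms] sn[OF assms])
  ultimately have v: "lap n w = a *\<^sub>R s w + b *\<^sub>R ddir s 1 w + p *\<^sub>R ddir s \<i> w + e *\<^sub>R n w"
    using v \<rho>(1) by simp
  have ds: "mink (ddir s X w) (s w) = 0" for X using sds[OF assms, of X] by (simp add: mink_commute)
  have "mink (ddir s 1 w) (lap n w) = b * \<rho>"
    unfolding v by (simp add: mink_add_right mink_scaleR_right \<rho>(2,4) dsn[OF assms] ds)
  moreover have "mink (ddir s \<i> w) (lap n w) = p * \<rho>"
    unfolding v using \<rho>(4) mink_commute[of "ddir s \<i> w" "ddir s 1 w"]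
    by (simp add: mink_add_right mink_scaleR_right \<rho>(3) dsn[OF assms] ds)
  ultimately have v: "lap n w = a *\<^sub>R s w + e *\<^sub>R n w"
    using v \<rho>(1) lap_n_tangent[OF assms] by simp
  have "mink (n w) (lap n w) = - ?k" by (simp add: mink_add_right nddn)
  moreover have "mink (n w) (lap n w) = e"
    unfolding v using sn[OF assms] mink_commute[of "n w" "s w"]
    by (simp add: mink_add_right mink_scaleR_right nn[OF assms])
  moreover have "mink (lap n w) c = 0" by (simp add: mink_add_left ddnc[OF assms])
  moreover have "mink (lap n w) c = - a + e * h"
    unfolding v by (simp add: mink_add_left mink_scaleR_left sc[OF assms] nc[OF assms])
  ultimately have "e = - ?k" "a = - ?k * h" by auto
  then show ?thesis by (simp only: v scaleR_add_right scaleR_scaleR) (rule add.commute)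
qed

end

section \<open>The splitting defined by a unit normal\<close>

locale normal_splitting =
  fixes U :: "complex set" and n :: "complex \<Rightarrow> real ^ 5" and S :: "complex \<Rightarrow> (complex ^ 5) set"
  assumes open_U: "open U" and smooth_n: "smooth_on U n"
    and nn: "w \<in> U \<Longrightarrow> mink (n w) (n w) = 1"
    and S_eq: "w \<in> U \<Longrightarrow> S w = orth {cvec (n w)}"
begin

abbreviation "nc w \<equiv> cvec (n w)"
abbreviation "dnc X w \<equiv> cvec (ddir n X w)"

lemma nc_nc: "w \<in> U \<Longrightarrow> mink (nc w) (nc w) = 1"
  by (simp add: mink_cvec nn)

lemma diff_n: "w \<in> U \<Longrightarrow> n differentiable (at w)"
  and diff_dn: "w \<in> U \<Longrightarrow> ddir n X differentiable (at w)"
  using smooth_n by (auto intro: smooth_on_differentiable smooth_on_ddir)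

lemma diff_nc: "w \<in> U \<Longrightarrow> (\<lambda>y. nc y) differentiable (at w)"
  and diff_dnc: "w \<in> U \<Longrightarrow> (\<lambda>y. dnc X y) differentiable (at w)"
  by (simp_all add: differentiable_linear[OF bounded_linear_cvec] diff_n diff_dn)

lemma ddir_nc: "w \<in> U \<Longrightarrow> ddir (\<lambda>y. nc y) X w = dnc X w"
  and ddir_dnc: "w \<in> U \<Longrightarrow> ddir (\<lambda>y. dnc X y) Y w = cvec (ddir (ddir n X) Y w)"
  by (simp_all add: ddir_linear[OF bounded_linear_cvec] diff_n diff_dn)

lemma dn_n: "w \<in> U \<Longrightarrow> mink (ddir n X w) (n w) = 0"
  using ddir_mink_const[OF open_U _ smooth_n smooth_n nn, of w X] by (simp add: mink_commute)

lemma dnc_nc: "w \<in> U \<Longrightarrow> mink (dnc X w) (nc w) = 0" "w \<in> U \<Longrightarrow> mink (nc w) (dnc X w) = 0"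
  using dn_n[of w X] by (simp_all add: mink_cvec mink_commute)

lemma ddir_scale_mink:
  assumes "w \<in> U" "f differentiable (at w)"
  shows "ddir (\<lambda>y. mink (f y) (nc y) *s nc y) X w =
      mink (f w) (nc w) *s dnc X w + (mink (f w) (dnc X w) + mink (ddir f X w) (nc w)) *s nc w"
    and "(\<lambda>y. mink (f y) (nc y) *s nc y) differentiable (at w)"
proof -
  have d: "(\<lambda>y. mink (f y) (nc y)) differentiable (at w)"
    by (rule differentiable_bilinear[OF bounded_bilinear_mink_complex assms(2) diff_nc[OF assms(1)]])
  show "(\<lambda>y. mink (f y) (nc y) *s nc y) differentiable (at w)"
    by (rule differentiable_bilinear[OF bounded_bilinear_scale d diff_nc[OF assms(1)]])
  show "ddir (\<lambda>y. mink (f y) (nc y) *s nc y) X w =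
      mink (f w) (nc w) *s dnc X w + (mink (f w) (dnc X w) + mink (ddir f X w) (nc w)) *s nc w"
    by (simp only: ddir_bilinear[OF bounded_bilinear_scale d diff_nc[OF assms(1)]]
        ddir_bilinear[OF bounded_bilinear_mink_complex assms(2) diff_nc[OF assms(1)]] ddir_nc[OF assms(1)])
qed

text \<open>The derivative of the normal part \<open>(f, n) n\<close> has tangential part
  \<open>(f, n) dn\<close>, because \<open>dn\<close> is orthogonal to \<open>n\<close>. Each
  projection therefore loses one cross term of \<open>df\<close>, and the two lost terms are the
  correction to \<open>df\<close>.\<close>

lemma conn_D_eq:
  assumes w: "w \<in> U" and f: "f differentiable (at w)"
  shows "conn_D S X f w = ddir f X w + mink (f w) (dnc X w) *s nc w - mink (f w) (nc w) *s dnc X w"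
proof -
  have 1: "ddir (\<lambda>y. proj (S y) (f y)) X w = ddir (\<lambda>y. f y - mink (f y) (nc y) *s nc y) X w"
    by (rule ddir_cong_open[OF open_U w]) (simp add: S_eq proj_orth_unit nc_nc)
  have 2: "ddir (\<lambda>y. proj (orth (S y)) (f y)) X w = ddir (\<lambda>y. mink (f y) (nc y) *s nc y) X w"
    by (rule ddir_cong_open[OF open_U w]) (simp add: S_eq proj_orth_orth_unit nc_nc)
  show ?thesis
    unfolding conn_D_def 1 2 ddir_diff[OF f ddir_scale_mink(2)[OF w f]] ddir_scale_mink(1)[OF w f]
    by (simp add: S_eq[OF w] proj_orth_unit proj_orth_orth_unit nc_nc[OF w] mink_linear dnc_nc[OF w])
qed

lemma conn_D_const:
  "w \<in> U \<Longrightarrow> conn_D S X (\<lambda>_. v) w = mink v (dnc X w) *s nc w - mink v (nc w) *s dnc X w"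
  by (simp add: conn_D_eq)

lemma form_N_eq:
  "w \<in> U \<Longrightarrow> form_N S w X v = mink v (nc w) *s dnc X w - mink v (dnc X w) *s nc w"
  by (simp add: form_N_def conn_D_const)

text \<open>The sign in \<open>star\<close> is absorbed by exchanging the two factors, which yields
  a single bivector to which the Leibniz rule applies.\<close>

lemma star_N_eq:
  "w \<in> U \<Longrightarrow> star (form_N S) w X v = wedge (dnc (\<i> * X) w) (nc w) v"
  by (simp add: star_def form_N_eq wedge_def)

lemma conn_D_cong:
  assumes "w \<in> U" "\<And>y. y \<in> U \<Longrightarrow> f y = g y"
  shows "conn_D S X f w = conn_D S X g w"
proof -
  have "ddir (\<lambda>y. proj (S y) (f y)) X w = ddir (\<lambda>y. proj (S y) (g y)) X w"
    "ddir (\<lambda>y. proj (orth (S y)) (f y)) X w = ddir (\<lambda>y. proj (orth (S y)) (g y)) X w"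
    using assms(2) by (auto intro!: ddir_cong_open[OF open_U assms(1)])
  then show ?thesis by (simp add: conn_D_def)
qed

text \<open>\<open>\<D>\<close> is a metric connection, so it acts on bivectors by the Leibniz rule.\<close>

lemma conn_D_End_wedge:
  assumes w: "w \<in> U" and a: "a differentiable (at w)" and b: "b differentiable (at w)"
    and E: "\<And>y v. y \<in> U \<Longrightarrow> E y v = wedge (a y) (b y) v"
  shows "conn_D_End S X E w v = wedge (conn_D S X a w) (b w) v + wedge (a w) (conn_D S X b w) v"
proof -
  note bil = bounded_bilinear_mink_complex
  have ma: "(\<lambda>y. mink v (a y)) differentiable (at w)" "ddir (\<lambda>y. mink v (a y)) X w = mink v (ddir a X w)"
    using differentiable_bilinear[OF bil differentiable_const a] ddir_bilinear[OF bil differentiable_const a]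
    by (simp_all add: mink_linear)
  have mb: "(\<lambda>y. mink v (b y)) differentiable (at w)" "ddir (\<lambda>y. mink v (b y)) X w = mink v (ddir b X w)"
    using differentiable_bilinear[OF bil differentiable_const b] ddir_bilinear[OF bil differentiable_const b]
    by (simp_all add: mink_linear)
  note dd = differentiable_bilinear[OF bounded_bilinear_scale ma(1) b]
    differentiable_bilinear[OF bounded_bilinear_scale mb(1) a]
  have "conn_D S X (\<lambda>y. E y v) w = conn_D S X (\<lambda>y. mink v (a y) *s b y - mink v (b y) *s a y) w"
    by (rule conn_D_cong[OF w]) (simp add: E wedge_def)
  also have "\<dots> = mink v (a w) *s ddir b X w + mink v (ddir a X w) *s b w
      - (mink v (b w) *s ddir a X w + mink v (ddir b X w) *s a w)
      + mink (mink v (a w) *s b w - mink v (b w) *s a w) (dnc X w) *s nc w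
      - mink (mink v (a w) *s b w - mink v (b w) *s a w) (nc w) *s dnc X w"
    by (simp only: conn_D_eq[OF w differentiable_diff[OF dd]] ddir_diff[OF dd]
        ddir_bilinear[OF bounded_bilinear_scale ma(1) b] ddir_bilinear[OF bounded_bilinear_scale mb(1) a]
        ma(2) mb(2))
  finally have 1: "conn_D S X (\<lambda>y. E y v) w = \<dots>" .
  show ?thesis
    unfolding conn_D_End_def 1 conn_D_const[OF w] E[OF w] conn_D_eq[OF w a] conn_D_eq[OF w b] wedge_def
      mink_linear mink_commute[of "nc w"] mink_commute[of "dnc X w"]
    by (simp add: vec_eq_iff algebra_simps)
qed

end

section \<open>The structure equations in a chart\<close>

text \<open>The commutator with a skew endomorphism is its derivation action on bivectors. This
  reduces the bracket of \<open>q\<close> with the star of \<open>form_N\<close> to evaluating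
  \<open>q\<close> on two vectors.\<close>

lemma wedge_bracket_wedge:
  "wedge a b (wedge c d v) - wedge c d (wedge a b v) = wedge (wedge a b c) d v + wedge c (wedge a b d) v"
  unfolding wedge_def mink_linear mink_commute[of c] mink_commute[of d]
  by (simp add: vec_eq_iff algebra_simps)

lemma wedge_linear:
  "wedge (a + a') b v = wedge a b v + wedge a' b v" "wedge a (b + b') v = wedge a b v + wedge a b' v"
  "wedge (a - a') b v = wedge a b v - wedge a' b v" "wedge a (b - b') v = wedge a b v - wedge a b' v"
  "wedge (r *s a) b v = r *s wedge a b v" "wedge a (r *s b) v = r *s wedge a b v"
  "wedge a a v = 0" "wedge 0 b v = 0" "wedge a 0 v = 0"
  by (simp_all add: wedge_def mink_linear vec_eq_iff algebra_simps)

locale cmc_chart = cmc_lift +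
  fixes S :: "complex \<Rightarrow> (complex ^ 5) set" and q :: endo_form
  assumes S_eq: "w \<in> U \<Longrightarrow> S w = orth {cvec (n w)}"
    and q_eq: "w \<in> U \<Longrightarrow> q w X v = complex_of_real h *s ((1/2) *s wedge (cvec (s w)) (cvec (ddir n X w)) v)"
begin

sublocale split: normal_splitting U n S
  by unfold_locales (use open_U smooth_n nn S_eq in auto)

text \<open>All scalars are moved into the second factor because \<open>conn_D_End_wedge\<close> and
  \<open>wedge_bracket_wedge\<close> expect plain bivectors.\<close>

lemma q_wedge:
  "w \<in> U \<Longrightarrow> q w X v = wedge (cvec (s w)) (cvec ((h / 2) *\<^sub>R ddir n X w)) v"
  by (simp add: q_eq cvec_linear wedge_linear)

lemma conn_D_s:
  assumes "w \<in> U"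
  shows "conn_D S X (\<lambda>y. cvec (s y)) w = cvec (ddir s X w)"
proof -
  have "(\<lambda>y. cvec (s y)) differentiable (at w)"
    by (rule differentiable_linear[OF bounded_linear_cvec diff_s[OF assms]])
  then show ?thesis
    by (simp add: split.conn_D_eq[OF assms] ddir_linear[OF bounded_linear_cvec diff_s[OF assms]]
        mink_cvec sn[OF assms] sdn[OF assms])
qed

lemma conn_D_n:
  assumes "w \<in> U"
  shows "conn_D S X (\<lambda>y. cvec (n y)) w = 0"
  by (simp add: split.conn_D_eq[OF assms split.diff_nc[OF assms]] split.ddir_nc[OF assms]
      mink_cvec nn[OF assms] ndn[OF assms])

text \<open>As \<open>(ddn, n) = -(dn, dn)\<close>, the added multiple of \<open>n\<close> is
  exactly what projects the second derivative of \<open>n\<close> tangentially.\<close>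

lemma conn_D_dn:
  assumes "w \<in> U"
  shows "conn_D S X (\<lambda>y. cvec (ddir n Y y)) w =
    cvec (ddir (ddir n Y) X w + mink (ddir n Y w) (ddir n X w) *\<^sub>R n w)"
  by (simp add: split.conn_D_eq[OF assms split.diff_dnc[OF assms]] split.ddir_dnc[OF assms]
      mink_cvec split.dn_n[OF assms] cvec_linear)

lemma dn_expand: "w \<in> U \<Longrightarrow> ddir n X w = Re X *\<^sub>R ddir n 1 w + Im X *\<^sub>R ddir n \<i> w"
  by (rule ddir_complex_expand[OF diff_n])

lemma ds_expand: "w \<in> U \<Longrightarrow> ddir s X w = Re X *\<^sub>R ddir s 1 w + Im X *\<^sub>R ddir s \<i> w"
  by (rule ddir_complex_expand[OF diff_s])

text \<open>Holds because \<open>dn\<close> is \<open>ds\<close> followed by a trace-free symmetric endomorphism.\<close>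

lemma ds_wedge_dn:
  assumes "w \<in> U"
  shows "wedge (cvec (ddir s X w)) (cvec (ddir n Y w)) v = wedge (cvec (ddir s Y w)) (cvec (ddir n X w)) v"
proof -
  obtain a b where ab: "ddir n 1 w = a *\<^sub>R ddir s 1 w + b *\<^sub>R ddir s \<i> w"
    "ddir n \<i> w = b *\<^sub>R ddir s 1 w - a *\<^sub>R ddir s \<i> w" using shape_operator[OF assms] .
  define x y where "x = cvec (ddir s 1 w)" and "y = cvec (ddir s \<i> w)"
  show ?thesis
    unfolding ds_expand[OF assms, of X] ds_expand[OF assms, of Y] dn_expand[OF assms, of X]
      dn_expand[OF assms, of Y] ab cvec_linear x_def[symmetric] y_def[symmetric] wedge_def mink_linear
    by (simp add: vec_eq_iff algebra_simps)
qed

text \<open>By the Leibniz rule two terms are to be skew-symmetrized: \<open>ds\<close> wedge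
  \<open>dn\<close>, which is symmetric by \<open>ds_wedge_dn\<close>, and \<open>s\<close> wedge
  the covariant derivative of \<open>dn\<close>, which is symmetric because second derivatives
  commute.\<close>

lemma ext_D_q:
  assumes "w \<in> U"
  shows "ext_D S q w X Y v = 0"
proof -
  have d: "(\<lambda>y. cvec (s y)) differentiable (at w)" "(\<lambda>y. cvec ((h / 2) *\<^sub>R ddir n X y)) differentiable (at w)" for X
    using differentiable_linear[OF bounded_linear_cvec diff_s[OF assms]]
      differentiable_linear[OF bounded_linear_cvec differentiable_linear[OF bounded_linear_scaleR_right diff_dn[OF assms]]]
    by auto
  have D: "conn_D S X (\<lambda>y. cvec ((h / 2) *\<^sub>R ddir n Y y)) w =
      complex_of_real (h / 2) *s cvec (ddir (ddir n Y) X w + mink (ddir n Y w) (ddir n X w) *\<^sub>R n w)" for X Y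
  proof -
    have "ddir (\<lambda>y. cvec ((h / 2) *\<^sub>R ddir n Y y)) X w = cvec ((h / 2) *\<^sub>R ddir (ddir n Y) X w)"
      by (simp only: ddir_linear[OF bounded_linear_cvec differentiable_linear[OF bounded_linear_scaleR_right diff_dn[OF assms]]]
          ddir_linear[OF bounded_linear_scaleR_right diff_dn[OF assms]])
    then show ?thesis
      by (simp only: split.conn_D_eq[OF assms d(2)])
         (simp add: mink_cvec mink_scaleR_left split.dn_n[OF assms] cvec_linear mink_linear vec_eq_iff
          algebra_simps)
  qed
  have E: "conn_D_End S X (\<lambda>y. q y Y) w v =
      wedge (cvec (ddir s X w)) (cvec ((h / 2) *\<^sub>R ddir n Y w)) v + wedge (cvec (s w))
        (complex_of_real (h / 2) *s cvec (ddir (ddir n Y) X w + mink (ddir n Y w) (ddir n X w) *\<^sub>R n w)) v" for X Y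
    using split.conn_D_End_wedge[OF assms d(1) d(2)[of Y], of "\<lambda>y. q y Y" X v] q_wedge
    by (simp only: conn_D_s[OF assms] D)
  show ?thesis
    unfolding ext_D_def E
    by (simp only: cvec_scaleR wedge_linear ds_wedge_dn[OF assms, of X Y] symm_n[OF assms, of X Y]
        mink_commute[of "ddir n X w" "ddir n Y w"] diff_self)
qed

text \<open>Both sides are computed to be \<open>J k h\<close> times \<open>s\<close> wedge
  \<open>n\<close>: the left one through the Laplacian of \<open>n\<close>, the right one through
  the action of \<open>q\<close> on \<open>dn\<close>.\<close>

lemma ext_D_star_N:
  assumes "w \<in> U"
  shows "ext_D S (star (form_N S)) w X Y v = 2 *s wedge_bracket q (star (form_N S)) w X Y v"
proof -
  \<comment> \<open>The oriented area of \<open>X\<close>, \<open>Y\<close> in the coordinate plane;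
    a 2-form on a surface is a multiple of it.\<close>
  define J where "J = Re X * Im Y - Im X * Re Y"
  define k where "k = mink (ddir n 1 w) (ddir n 1 w) + mink (ddir n \<i> w) (ddir n \<i> w)"
  have E: "conn_D_End S X (\<lambda>y. star (form_N S) y Y) w v =
      wedge (cvec (ddir (ddir n (\<i> * Y)) X w)) (cvec (n w)) v" for X Y
    using split.conn_D_End_wedge[OF assms split.diff_dnc[OF assms, of "\<i> * Y"] split.diff_nc[OF assms],
        of "\<lambda>y. star (form_N S) y Y" X v] split.star_N_eq
    by (simp add: conn_D_n[OF assms] conn_D_dn[OF assms] wedge_linear cvec_linear)
  have e1: "ddir (ddir n (\<i> * Y)) X w = Re X *\<^sub>R ddir (\<lambda>y. - Im Y *\<^sub>R ddir n 1 y + Re Y *\<^sub>R ddir n \<i> y) 1 w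
     + Im X *\<^sub>R ddir (\<lambda>y. - Im Y *\<^sub>R ddir n 1 y + Re Y *\<^sub>R ddir n \<i> y) \<i> w" for X Y
  proof -
    have "ddir (ddir n (\<i> * Y)) Z w = ddir (\<lambda>y. - Im Y *\<^sub>R ddir n 1 y + Re Y *\<^sub>R ddir n \<i> y) Z w" for Z
      by (rule ddir_cong_open[OF open_U assms]) (simp add: dn_expand[of _ "\<i> * Y"])
    then show ?thesis using ddir_complex_expand[OF diff_dn[OF assms], of "\<i> * Y" X] by simp
  qed
  have e2: "ddir (\<lambda>y. - Im Y *\<^sub>R ddir n 1 y + Re Y *\<^sub>R ddir n \<i> y) Z w =
      - Im Y *\<^sub>R ddir (ddir n 1) Z w + Re Y *\<^sub>R ddir (ddir n \<i>) Z w" for Y Z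
    by (simp only: ddir_add[OF differentiable_linear[OF bounded_linear_scaleR_right diff_dn[OF assms]]
          differentiable_linear[OF bounded_linear_scaleR_right diff_dn[OF assms]]]
        ddir_linear[OF bounded_linear_scaleR_right diff_dn[OF assms]])
  have 2: "ddir (ddir n (\<i> * Y)) X w - ddir (ddir n (\<i> * X)) Y w = - J *\<^sub>R lap n w"
    unfolding e1 e2 J_def symm_n[OF assms, of \<i> 1] by (simp add: algebra_simps)
  have "ext_D S (star (form_N S)) w X Y v = wedge (cvec (- J *\<^sub>R lap n w)) (cvec (n w)) v"
    by (simp only: ext_D_def E 2[symmetric] cvec_diff wedge_linear)
  \<comment> \<open>The Laplacian is \<open>-k (n + h s)\<close>, and its \<open>n\<close>-component
    drops out when wedged with \<open>n\<close>.\<close>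
  also have "\<dots> = complex_of_real (J * k * h) *s wedge (cvec (s w)) (cvec (n w)) v"
    unfolding laplace_n[OF assms] k_def[symmetric] by (simp add: cvec_linear wedge_linear)
  finally have L: "ext_D S (star (form_N S)) w X Y v = \<dots>" .
  \<comment> \<open>Here \<open>q\<close> annihilates \<open>n\<close> and sends \<open>dn\<close>
    to a multiple of \<open>s\<close>, so only one term of the derivation action survives.\<close>
  have B: "q w X (star (form_N S) w Y u) - star (form_N S) w Y (q w X u) =
      - (complex_of_real (h / 2 * mink (ddir n (\<i> * Y) w) (ddir n X w)) *s wedge (cvec (s w)) (cvec (n w)) u)" for X Y u
    unfolding q_wedge[OF assms] split.star_N_eq[OF assms] wedge_bracket_wedge
    by (simp add: wedge_def[of "cvec (s w)"] mink_cvec mink_scaleR_right split.dn_n[OF assms] ndn[OF assms]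
        sdn[OF assms] mink_commute[of "ddir n (\<i> * Y) w" "s w"] mink_commute[of "n w" "s w"] sn[OF assms]
        mink_linear cvec_linear wedge_linear)
       (simp add: wedge_def mink_linear vec_eq_iff algebra_simps)
  have K: "mink (ddir n (\<i> * X) w) (ddir n Y w) - mink (ddir n (\<i> * Y) w) (ddir n X w) = J * k"
    unfolding dn_expand[OF assms, of X] dn_expand[OF assms, of Y] dn_expand[OF assms, of "\<i> * X"]
      dn_expand[OF assms, of "\<i> * Y"] J_def k_def
    by (simp add: mink_linear mink_scaleR_left mink_scaleR_right mink_commute algebra_simps)
  have "2 *s wedge_bracket q (star (form_N S)) w X Y v =
      complex_of_real (h * (mink (ddir n (\<i> * X) w) (ddir n Y w) - mink (ddir n (\<i> * Y) w) (ddir n X w)))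
        *s wedge (cvec (s w)) (cvec (n w)) v"
    unfolding wedge_bracket_def B by (simp add: vec_eq_iff algebra_simps)
  also have "\<dots> = complex_of_real (J * k * h) *s wedge (cvec (s w)) (cvec (n w)) v"
    unfolding K by (simp add: mult.commute)
  finally show ?thesis using L by simp
qed

lemma conn_zeta_p:
  assumes "w \<in> U" "\<zeta> \<noteq> 0"
    and p: "\<And>y. y \<in> U \<Longrightarrow> p y = cvec c + (complex_of_real h * ((inverse \<zeta> + \<zeta>) / 2 - 1)) *s cvec (n y)"
  shows "conn_zeta S q \<zeta> X p w = 0"
proof -
  define \<kappa> where "\<kappa> = complex_of_real h * ((inverse \<zeta> + \<zeta>) / 2 - 1)"
  have p: "p y = cvec c + \<kappa> *s cvec (n y)" if "y \<in> U" for y using p[OF that] by (simp add: \<kappa>_def)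
  have bl: "bounded_linear ((*s) \<kappa> :: complex ^ 5 \<Rightarrow> _)"
    by (rule bounded_bilinear.bounded_linear_right[OF bounded_bilinear_scale])
  have dp: "(\<lambda>y. \<kappa> *s cvec (n y)) differentiable (at w)"
    by (rule differentiable_linear[OF bl split.diff_nc[OF assms(1)]])
  have pn: "mink (p w) (cvec (n w)) = complex_of_real h + \<kappa>"
    using nc[OF assms(1)] mink_commute[of c "n w"] by (simp add: p[OF assms(1)] mink_linear mink_cvec nn[OF assms(1)])
  have pdn: "mink (p w) (cvec (ddir n X w)) = 0" for X
    using dnc[OF assms(1)] mink_commute[of c "ddir n X w"]
    by (simp add: p[OF assms(1)] mink_linear mink_cvec ndn[OF assms(1)])
  have ps: "mink (p w) (cvec (s w)) = - 1"
    using sc[OF assms(1)] sn[OF assms(1)] mink_commute[of c "s w"] mink_commute[of "n w" "s w"]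
    by (simp add: p[OF assms(1)] mink_linear mink_cvec)
  have "conn_D S X p w = conn_D S X (\<lambda>y. cvec c + \<kappa> *s cvec (n y)) w"
    by (rule split.conn_D_cong[OF assms(1) p])
  also have "\<dots> = \<kappa> *s cvec (ddir n X w) - (complex_of_real h + \<kappa>) *s cvec (ddir n X w)"
    using pn pdn[of X] unfolding p[OF assms(1)]
    by (simp add: split.conn_D_eq[OF assms(1) differentiable_add[OF differentiable_const dp]]
        ddir_add[OF differentiable_const dp] ddir_linear[OF bl split.diff_nc[OF assms(1)]] split.ddir_nc[OF assms(1)])
  finally have 1: "conn_D S X p w = - complex_of_real h *s cvec (ddir n X w)"
    by (simp add: vec_eq_iff algebra_simps)
  have 2: "form_N S w X (p w) = (complex_of_real h + \<kappa>) *s cvec (ddir n X w)" for X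
    by (simp add: split.form_N_eq[OF assms(1)] pn pdn)
  have 3: "q w X (p w) = - (complex_of_real h / 2) *s cvec (ddir n X w)" for X
    by (simp add: q_wedge[OF assms(1)] wedge_def cvec_linear mink_linear ps pdn)
  define z where "z = inverse \<zeta>"
  have z: "z * \<zeta> = 1" "inverse (\<zeta>\<^sup>2) = z\<^sup>2"
    using assms(2) by (simp_all add: z_def power_inverse)
  have \<kappa>: "\<kappa> = complex_of_real h * ((z + \<zeta>) / 2 - 1)" by (simp add: \<kappa>_def z_def)
  \<comment> \<open>A scalar identity for each component, with \<open>u\<close> from
    \<open>dn\<close> along \<open>X\<close> and \<open>t\<close> from \<open>dn\<close> along
    \<open>\<i> * X\<close>. The \<open>t\<close>-terms cancel identically; the
    \<open>u\<close>-terms leave the factor \<open>z * \<zeta> - 1\<close>, which vanishes.\<close>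
  have alg: "- H * u + z * ((1/2) * ((H + \<kappa>') * u - \<i> * ((H + \<kappa>') * t))) + \<zeta> * ((1/2) * ((H + \<kappa>') * u + \<i> * ((H + \<kappa>') * t)))
     + (z\<^sup>2 - 1) * ((1/2) * (- (H / 2) * u - \<i> * (- (H / 2) * t))) + (\<zeta>\<^sup>2 - 1) * ((1/2) * (- (H / 2) * u + \<i> * (- (H / 2) * t))) = 0"
    (is "?L = 0") if "\<kappa>' = H * ((z + \<zeta>) / 2 - 1)" for H \<kappa>' u t
  proof -
    have "?L = H / 2 * (z * \<zeta> - 1) * u"
      unfolding that by (simp add: field_simps power2_eq_square)
    then show ?thesis by (simp add: z)
  qed
  show ?thesis
    unfolding conn_zeta_def part10_def part01_def 1 2 3 z(2) z_def[symmetric]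
    by (simp only: vec_eq_iff vector_add_component vector_minus_component vector_smult_component zero_index)
       (intro allI alg[OF \<kappa>])
qed

end

section \<open>Charts and the central sphere congruence\<close>

lemma chart_coord_param:
  assumes "is_chart \<kappa>"
  shows "p \<in> dom_of \<kappa> \<Longrightarrow> param \<kappa> (coord \<kappa> p) = p"
    and "w \<in> coord \<kappa> ` dom_of \<kappa> \<Longrightarrow> coord \<kappa> (param \<kappa> w) = w"
    and "w \<in> coord \<kappa> ` dom_of \<kappa> \<Longrightarrow> param \<kappa> w \<in> dom_of \<kappa>"
  using assms unfolding is_chart_def homeomorphism_def by auto

lemma chart_open_image:
  assumes "is_chart \<kappa>" "open V"
  shows "open (coord \<kappa> ` (dom_of \<kappa> \<inter> V))"
proof -
  have hom: "homeomorphism (dom_of \<kappa>) (coord \<kappa> ` dom_of \<kappa>) (coord \<kappa>) (param \<kappa>)"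
    and op: "open (coord \<kappa> ` dom_of \<kappa>)" using assms(1) by (auto simp: is_chart_def)
  have "openin (top_of_set (dom_of \<kappa>)) (dom_of \<kappa> \<inter> V)" using assms(2) by (rule openin_open_Int)
  from homeomorphism_imp_open_map[OF hom this] show ?thesis
    by (rule openin_open_trans[OF _ op])
qed

lemma del_z_cvec:
  assumes "f differentiable (at w)"
  shows "del_z (\<lambda>y. cvec (f y)) w = (1/2) *s (cvec (ddir f 1 w) - \<i> *s cvec (ddir f \<i> w))"
    and "del_zbar (\<lambda>y. cvec (f y)) w = (1/2) *s (cvec (ddir f 1 w) + \<i> *s cvec (ddir f \<i> w))"
  by (simp_all add: del_z_def del_zbar_def ddir_linear[OF bounded_linear_cvec assms])

text \<open>The imaginary part vanishes because second derivatives commute.\<close>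

lemma del_z_del_zbar_cvec:
  assumes W: "open W" "w \<in> W" and f: "smooth_on W f"
  shows "del_z (del_zbar (\<lambda>y. cvec (f y))) w = (1/4) *s cvec (ddir (ddir f 1) 1 w + ddir (ddir f \<i>) \<i> w)"
proof -
  have bl: "bounded_linear ((*s) c :: complex ^ 5 \<Rightarrow> _)" for c :: complex
    by (rule bounded_bilinear.bounded_linear_right[OF bounded_bilinear_scale])
  have d: "ddir f X differentiable (at w)" for X
    using smooth_on_differentiable[OF smooth_on_ddir[OF f] W(2)] .
  have c: "(\<lambda>y. cvec (ddir f X y)) differentiable (at w)" for X
    by (rule differentiable_linear[OF bounded_linear_cvec d])
  have "ddir (del_zbar (\<lambda>y. cvec (f y))) X w =
      ddir (\<lambda>y. (1/2) *s (cvec (ddir f 1 y) + \<i> *s cvec (ddir f \<i> y))) X w" for X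
    by (rule ddir_cong_open[OF W]) (rule del_z_cvec(2)[OF smooth_on_differentiable[OF f]])
  also have "\<dots> X = (1/2) *s (cvec (ddir (ddir f 1) X w) + \<i> *s cvec (ddir (ddir f \<i>) X w))" for X
    by (simp only: ddir_linear[OF bl differentiable_add[OF c differentiable_linear[OF bl c]]]
        ddir_add[OF c differentiable_linear[OF bl c]] ddir_linear[OF bl c]
        ddir_linear[OF bounded_linear_cvec d])
  finally show ?thesis
    by (simp add: del_z_def ddir_commute[OF W f, of \<i> 1] vec_eq_iff cvec_def algebra_simps)
qed

context
  fixes A :: "('m::{t2_space, second_countable_topology}) chart set"
    and \<Lambda> :: "'m \<Rightarrow> (real ^ 5) set" and \<kappa> p V \<sigma> f
  assumes \<kappa>: "\<kappa> \<in> A" "is_chart \<kappa>" "p \<in> dom_of \<kappa>" and \<sigma>: "p \<in> V" "lift A \<Lambda> V \<sigma>"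
    and f_def: "f = \<sigma> \<circ> param \<kappa>"
begin

lemma lift_smooth:
  "open (coord \<kappa> ` (dom_of \<kappa> \<inter> V))" "coord \<kappa> p \<in> coord \<kappa> ` (dom_of \<kappa> \<inter> V)"
  "smooth_on (coord \<kappa> ` (dom_of \<kappa> \<inter> V)) f"
  using \<kappa> \<sigma> by (auto simp: lift_def smooth_section_def f_def intro: chart_open_image)

lemma lift_del_z:
  defines "w \<equiv> coord \<kappa> p" and "s \<equiv> cvec \<circ> \<sigma> \<circ> param \<kappa>"
  shows "del_z s w = (1/2) *s (cvec (ddir f 1 w) - \<i> *s cvec (ddir f \<i> w))"
    and "del_zbar s w = (1/2) *s (cvec (ddir f 1 w) + \<i> *s cvec (ddir f \<i> w))"
    and "del_z (del_zbar s) w = (1/4) *s cvec (ddir (ddir f 1) 1 w + ddir (ddir f \<i>) \<i> w)"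
proof -
  have s: "s = (\<lambda>y. cvec (f y))" by (simp add: s_def f_def fun_eq_iff)
  have d: "f differentiable (at w)" unfolding w_def
    by (rule smooth_on_differentiable[OF lift_smooth(3,2)])
  show "del_z s w = (1/2) *s (cvec (ddir f 1 w) - \<i> *s cvec (ddir f \<i> w))"
    "del_zbar s w = (1/2) *s (cvec (ddir f 1 w) + \<i> *s cvec (ddir f \<i> w))"
    "del_z (del_zbar s) w = (1/4) *s cvec (ddir (ddir f 1) 1 w + ddir (ddir f \<i>) \<i> w)"
    unfolding s using del_z_cvec[OF d] del_z_del_zbar_cvec[OF lift_smooth] by (simp_all add: w_def)
qed

text \<open>The real partial derivatives are recovered from the complex generators as
  \<open>f_z + f_zbar\<close> and \<open>\<i> (f_z - f_zbar)\<close>.\<close>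

lemma lift_in_Lambda1:
  defines "w \<equiv> coord \<kappa> p"
  shows "cvec (\<sigma> p) \<in> Lambda1 A \<Lambda> p" "cvec (ddir f 1 w) \<in> Lambda1 A \<Lambda> p" "cvec (ddir f \<i> w) \<in> Lambda1 A \<Lambda> p"
proof -
  let ?s = "cvec \<circ> \<sigma> \<circ> param \<kappa>"
  have "{?s w, del_z ?s w, del_zbar ?s w} \<subseteq> Lambda1 A \<Lambda> p"
    unfolding Lambda1_def
    by (rule subset_trans[OF _ vec.span_superset], rule Union_upper)
       (unfold mem_Collect_eq w_def, rule exI[of _ \<kappa>], rule exI[of _ V], rule exI[of _ \<sigma>],
        use \<kappa> \<sigma> in \<open>simp add: Let_def\<close>)
  then have b: "?s w \<in> Lambda1 A \<Lambda> p" "del_z ?s w \<in> Lambda1 A \<Lambda> p" "del_zbar ?s w \<in> Lambda1 A \<Lambda> p" by auto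
  show "cvec (\<sigma> p) \<in> Lambda1 A \<Lambda> p"
    using b(1) chart_coord_param(1)[OF \<kappa>(2,3)] by (simp add: w_def)
  have "del_z ?s w + del_zbar ?s w \<in> Lambda1 A \<Lambda> p"
    using b(2,3) unfolding Lambda1_def by (rule vec.span_add)
  also have "del_z ?s w + del_zbar ?s w = cvec (ddir f 1 w)"
    unfolding w_def lift_del_z by (simp add: vec_eq_iff)
  finally show "cvec (ddir f 1 w) \<in> Lambda1 A \<Lambda> p" .
  have "\<i> *s (del_z ?s w - del_zbar ?s w) \<in> Lambda1 A \<Lambda> p"
    using b(2,3) unfolding Lambda1_def by (rule vec.span_scale[OF vec.span_diff])
  also have "\<i> *s (del_z ?s w - del_zbar ?s w) = cvec (ddir f \<i> w)"
    unfolding w_def lift_del_z by (simp add: vec_eq_iff algebra_simps)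
  finally show "cvec (ddir f \<i> w) \<in> Lambda1 A \<Lambda> p" .
qed

lemma lift_in_central_sphere:
  defines "w \<equiv> coord \<kappa> p"
  shows "cvec (\<sigma> p) \<in> central_sphere A \<Lambda> p"
    "cvec (ddir f 1 w) \<in> central_sphere A \<Lambda> p" "cvec (ddir f \<i> w) \<in> central_sphere A \<Lambda> p"
    "cvec (ddir (ddir f 1) 1 w + ddir (ddir f \<i>) \<i> w) \<in> central_sphere A \<Lambda> p"
proof -
  let ?s = "cvec \<circ> \<sigma> \<circ> param \<kappa>"
  have "{?s w, del_z ?s w, del_zbar ?s w, del_z (del_zbar ?s) w} \<subseteq> central_sphere A \<Lambda> p"
    unfolding central_sphere_def
    by (rule subset_trans[OF _ vec.span_superset], rule Union_upper)
       (unfold mem_Collect_eq w_def, rule exI[of _ \<kappa>], rule exI[of _ V], rule exI[of _ \<sigma>],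
        use \<kappa> \<sigma> in \<open>simp add: Let_def\<close>)
  then have b: "?s w \<in> central_sphere A \<Lambda> p" "del_z ?s w \<in> central_sphere A \<Lambda> p"
    "del_zbar ?s w \<in> central_sphere A \<Lambda> p" "del_z (del_zbar ?s) w \<in> central_sphere A \<Lambda> p" by auto
  show "cvec (\<sigma> p) \<in> central_sphere A \<Lambda> p"
    using b(1) chart_coord_param(1)[OF \<kappa>(2,3)] by (simp add: w_def)
  have "del_z ?s w + del_zbar ?s w \<in> central_sphere A \<Lambda> p"
    using b(2,3) unfolding central_sphere_def by (rule vec.span_add)
  also have "del_z ?s w + del_zbar ?s w = cvec (ddir f 1 w)"
    unfolding w_def lift_del_z by (simp add: vec_eq_iff)
  finally show "cvec (ddir f 1 w) \<in> central_sphere A \<Lambda> p" .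
  have "\<i> *s (del_z ?s w - del_zbar ?s w) \<in> central_sphere A \<Lambda> p"
    using b(2,3) unfolding central_sphere_def by (rule vec.span_scale[OF vec.span_diff])
  also have "\<i> *s (del_z ?s w - del_zbar ?s w) = cvec (ddir f \<i> w)"
    unfolding w_def lift_del_z by (simp add: vec_eq_iff algebra_simps)
  finally show "cvec (ddir f \<i> w) \<in> central_sphere A \<Lambda> p" .
  \<comment> \<open>The Laplacian is four times the mixed complex derivative.\<close>
  have "4 *s del_z (del_zbar ?s) w \<in> central_sphere A \<Lambda> p"
    using b(4) unfolding central_sphere_def by (rule vec.span_scale)
  also have "4 *s del_z (del_zbar ?s) w = cvec (ddir (ddir f 1) 1 w + ddir (ddir f \<i>) \<i> w)"
    unfolding w_def lift_del_z by (simp add: vec_eq_iff)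
  finally show "cvec (ddir (ddir f 1) 1 w + ddir (ddir f \<i>) \<i> w) \<in> central_sphere A \<Lambda> p" .
qed

lemma lift_normal:
  defines "w \<equiv> coord \<kappa> p"
  assumes "n \<in> orth (real_central_sphere A \<Lambda> p)"
  shows "mink (\<sigma> p) n = 0" "mink (ddir f X w) n = 0"
    "mink (ddir (ddir f 1) 1 w + ddir (ddir f \<i>) \<i> w) n = 0"
proof -
  have o: "mink v n = 0" if "cvec v \<in> central_sphere A \<Lambda> p" for v
    using assms(2) that by (simp add: orth_def real_central_sphere_def mink_commute[of v n])
  note l = lift_in_central_sphere[folded w_def]
  show "mink (\<sigma> p) n = 0" "mink (ddir (ddir f 1) 1 w + ddir (ddir f \<i>) \<i> w) n = 0"
    by (rule o, rule l)+
  have d: "f differentiable (at w)" unfolding w_def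
    by (rule smooth_on_differentiable[OF lift_smooth(3,2)])
  show "mink (ddir f X w) n = 0"
    unfolding ddir_complex_expand[OF d, of X] by (simp add: mink_linear mink_scaleR_left o l)
qed

text \<open>Transfers orthogonality from real to complex: the generators are complex combinations of
  real vectors lying in the real central sphere.\<close>

lemma lift_generators_normal:
  assumes "n \<in> orth (real_central_sphere A \<Lambda> p)"
  shows "(let s = cvec \<circ> \<sigma> \<circ> param \<kappa>; w = coord \<kappa> p
           in {s w, del_z s w, del_zbar s w, del_z (del_zbar s) w}) \<subseteq> orth {cvec n}"
proof -
  have "mink (cvec (\<sigma> p)) (cvec n) = 0" "mink (cvec (ddir f X (coord \<kappa> p))) (cvec n) = 0"
    "mink (cvec (ddir (ddir f 1) 1 (coord \<kappa> p) + ddir (ddir f \<i>) \<i> (coord \<kappa> p))) (cvec n) = 0" for X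
    by (simp_all only: mink_cvec lift_normal[OF assms] of_real_0)
  then show ?thesis
    unfolding Let_def lift_del_z
    by (simp add: mem_orth_singleton mink_linear chart_coord_param(1)[OF \<kappa>(2,3)])
qed

end

lemma subspace_orth: "vec.subspace (orth {n})"
  by (simp add: vec.subspace_def mem_orth_singleton mink_linear)

text \<open>Treats all charts and lifts in the span at once: each choice contributes generators
  normal to \<open>n\<close>, and \<open>orth {cvec n}\<close> is a subspace.\<close>

lemma central_sphere_subset_orth:
  fixes A :: "('m::{t2_space, second_countable_topology}) chart set"
  assumes "\<And>\<kappa>. \<kappa> \<in> A \<Longrightarrow> is_chart \<kappa>" "n \<in> orth (real_central_sphere A \<Lambda> p)"
  shows "central_sphere A \<Lambda> p \<subseteq> orth {cvec n}"
  unfolding central_sphere_def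
proof (rule vec.span_minimal[OF Union_least subspace_orth], clarify)
  fix \<kappa> V \<sigma> x
  assume "\<kappa> \<in> A" "p \<in> dom_of \<kappa>" "p \<in> V" "lift A \<Lambda> V \<sigma>"
    and x: "x \<in> (let s = cvec \<circ> \<sigma> \<circ> param \<kappa>; w = coord \<kappa> p
           in {s w, del_z s w, del_zbar s w, del_z (del_zbar s) w})"
  then show "x \<in> orth {cvec n}"
    using lift_generators_normal[OF _ assms(1) _ _ _ refl assms(2), of \<kappa> V \<sigma>] by blast
qed

section \<open>Surfaces of constant mean curvature\<close>

text \<open>The vector picked by \<open>SOME\<close> is a non-zero multiple of
  \<open>\<sigma>\<close>, the factor cancels in the quotient, and the normalization against
  \<open>vinf\<close> fixes the scale of \<open>u\<close>.\<close>

lemma sigma_inf_eq: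
  assumes "\<Lambda> p = span {\<sigma>}" "\<sigma> \<noteq> 0" "u \<in> \<Lambda> p" "mink u vinf = - 1"
  shows "sigma_inf \<Lambda> vinf p = u"
proof -
  have "\<sigma> \<in> \<Lambda> p \<and> \<sigma> \<noteq> 0" using assms by (simp add: span_base)
  then have some: "(SOME x. x \<in> \<Lambda> p \<and> x \<noteq> 0) \<in> \<Lambda> p \<and> (SOME x. x \<in> \<Lambda> p \<and> x \<noteq> 0) \<noteq> 0" by (rule someI)
  obtain r t where rt: "(SOME x. x \<in> \<Lambda> p \<and> x \<noteq> 0) = r *\<^sub>R \<sigma>" "u = t *\<^sub>R \<sigma>"
    using some assms(1,3) by (auto simp: span_singleton)
  have "r \<noteq> 0" using some rt by auto
  have "t * mink \<sigma> vinf = - 1" using assms(4) rt by (simp add: mink_scaleR_left)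
  moreover from this have "mink \<sigma> vinf \<noteq> 0" by auto
  ultimately have "t = - 1 / mink \<sigma> vinf" "mink \<sigma> vinf \<noteq> 0" by (simp_all only: eq_divide_eq) simp_all
  then show ?thesis
    unfolding sigma_inf_def Let_def rt using \<open>r \<noteq> 0\<close> by (simp add: mink_scaleR_left)
qed

locale cmc_surface =
  fixes M :: "('m::{t2_space, second_countable_topology}) set"
    and A :: "'m chart set" and \<Lambda> :: "'m \<Rightarrow> (real ^ 5) set"
    and vinf :: "real ^ 5" and N :: "'m \<Rightarrow> real ^ 5" and h :: real
  assumes surface: "oriented_surface M A" and conf: "conformal_surface M A \<Lambda>"
    and hol: "holomorphic_atlas A \<Lambda>" and space: "surface_in_space_form M \<Lambda> vinf"
    and normal: "unit_normal M A \<Lambda> vinf N"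
    and mc: "p \<in> M \<Longrightarrow> mean_curvature A \<Lambda> vinf p = h"
begin

abbreviation "\<sigma>inf \<equiv> sigma_inf \<Lambda> vinf"

lemma chart: "\<kappa> \<in> A \<Longrightarrow> is_chart \<kappa>"
  and dom_subset: "\<kappa> \<in> A \<Longrightarrow> dom_of \<kappa> \<subseteq> M"
  and M_cover: "p \<in> M \<Longrightarrow> \<exists>\<kappa>\<in>A. p \<in> dom_of \<kappa>"
  using surface by (auto simp: oriented_surface_def)

lemma open_dom: "\<kappa> \<in> A \<Longrightarrow> open (dom_of \<kappa>)"
  using chart by (auto simp: is_chart_def)

lemma open_M: "open M"
  using surface open_dom by (auto simp: oriented_surface_def)

lemma open_image: "\<kappa> \<in> A \<Longrightarrow> open (coord \<kappa> ` dom_of \<kappa>)"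
  using chart by (auto simp: is_chart_def)

lemmas coord_param = chart_coord_param[OF chart]

lemma param_in_M: "\<kappa> \<in> A \<Longrightarrow> w \<in> coord \<kappa> ` dom_of \<kappa> \<Longrightarrow> param \<kappa> w \<in> M"
  using coord_param(3) dom_subset by blast

lemma smooth_section_chart:
  assumes "smooth_section A M f" "\<kappa> \<in> A"
  shows "smooth_on (coord \<kappa> ` dom_of \<kappa>) (f \<circ> param \<kappa>)"
proof -
  have "dom_of \<kappa> \<inter> M = dom_of \<kappa>" using dom_subset[OF assms(2)] by auto
  with assms show ?thesis unfolding smooth_section_def by metis
qed

lemma smooth_sectionI:
  assumes "\<And>\<kappa>. \<kappa> \<in> A \<Longrightarrow> smooth_on (coord \<kappa> ` dom_of \<kappa>) (f \<circ> param \<kappa>)"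
  shows "smooth_section A M f"
  unfolding smooth_section_def using assms by (auto intro: smooth_on_subset)

lemma smooth_N: "\<kappa> \<in> A \<Longrightarrow> smooth_on (coord \<kappa> ` dom_of \<kappa>) (N \<circ> param \<kappa>)"
  using normal by (auto simp: unit_normal_def intro: smooth_section_chart)

lemma N_orth: "p \<in> M \<Longrightarrow> N p \<in> orth (real_central_sphere A \<Lambda> p)"
  and N_unit: "p \<in> M \<Longrightarrow> mink (N p) (N p) = 1"
  and v_perp_N: "p \<in> M \<Longrightarrow> v_perp A \<Lambda> vinf p = h *\<^sub>R N p"
  using normal mc by (auto simp: unit_normal_def)

lemma local_lift:
  assumes "p \<in> M"
  obtains V \<sigma> where "p \<in> V" "V \<subseteq> M" "lift A \<Lambda> V \<sigma>" "\<And>x. x \<in> V \<Longrightarrow> \<Lambda> x = span {\<sigma> x}"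
    "\<And>x. x \<in> V \<Longrightarrow> \<sigma> x \<noteq> 0"
  using conf assms unfolding conformal_surface_def null_line_subbundle_def light_cone_def
  by (metis (no_types, lifting) lift_def)

lemma sigma_inf_props:
  assumes "p \<in> M"
  shows "\<sigma>inf p \<in> \<Lambda> p" "\<sigma>inf p \<noteq> 0" "mink (\<sigma>inf p) (\<sigma>inf p) = 0" "mink (\<sigma>inf p) vinf = - 1"
proof -
  obtain u where u: "u \<in> \<Lambda> p" "u \<in> space_form vinf"
    using space assms by (auto simp: surface_in_space_form_def)
  obtain V \<sigma> where "p \<in> V" "\<And>x. x \<in> V \<Longrightarrow> \<Lambda> x = span {\<sigma> x}" "\<And>x. x \<in> V \<Longrightarrow> \<sigma> x \<noteq> 0"
    using local_lift[OF assms] by metis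
  then have "\<sigma>inf p = u" using u by (intro sigma_inf_eq) (auto simp: space_form_def)
  with u show "\<sigma>inf p \<in> \<Lambda> p" "\<sigma>inf p \<noteq> 0" "mink (\<sigma>inf p) (\<sigma>inf p) = 0" "mink (\<sigma>inf p) vinf = - 1"
    by (auto simp: space_form_def light_cone_def)
qed

lemma sigma_inf_scale:
  assumes "p \<in> M" "\<Lambda> p = span {\<sigma>}" "\<sigma> \<noteq> 0"
  shows "mink \<sigma> vinf \<noteq> 0" "\<sigma>inf p = - inverse (mink \<sigma> vinf) *\<^sub>R \<sigma>"
proof -
  obtain t where t: "\<sigma>inf p = t *\<^sub>R \<sigma>"
    using sigma_inf_props(1)[OF assms(1)] assms(2) by (auto simp: span_singleton)
  then have "t * mink \<sigma> vinf = - 1"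
    using sigma_inf_props(4)[OF assms(1)] by (simp add: mink_scaleR_left)
  moreover from this have "mink \<sigma> vinf \<noteq> 0" by auto
  ultimately have "mink \<sigma> vinf \<noteq> 0" "t = - inverse (mink \<sigma> vinf)"
    by (simp_all add: eq_neg_iff_add_eq_0 field_simps)
  with t show "mink \<sigma> vinf \<noteq> 0" "\<sigma>inf p = - inverse (mink \<sigma> vinf) *\<^sub>R \<sigma>" by simp_all
qed

text \<open>The pointwise choice in \<open>sigma_inf\<close> hides its smoothness; near each point
  it is the quotient of a smooth local lift by its non-vanishing product with
  \<open>vinf\<close>.\<close>

lemma smooth_sigma_inf:
  assumes \<kappa>: "\<kappa> \<in> A"
  shows "smooth_on (coord \<kappa> ` dom_of \<kappa>) (\<sigma>inf \<circ> param \<kappa>)"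
proof (rule smooth_on_local)
  fix w assume w: "w \<in> coord \<kappa> ` dom_of \<kappa>"
  obtain V \<sigma> where V: "param \<kappa> w \<in> V" "V \<subseteq> M" "lift A \<Lambda> V \<sigma>" "\<And>x. x \<in> V \<Longrightarrow> \<Lambda> x = span {\<sigma> x}"
    "\<And>x. x \<in> V \<Longrightarrow> \<sigma> x \<noteq> 0"
    using local_lift[OF param_in_M[OF \<kappa> w]] by metis
  define W where "W = coord \<kappa> ` (dom_of \<kappa> \<inter> V)"
  define f where "f = \<sigma> \<circ> param \<kappa>"
  have W: "open W" "smooth_on W f"
    using V(3) \<kappa> chart_open_image[OF chart[OF \<kappa>]] by (auto simp: lift_def smooth_section_def W_def f_def)
  have wW: "w \<in> W"
    using coord_param(2,3)[OF \<kappa> w] V(1) unfolding W_def by (metis IntI image_eqI)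
  have par: "param \<kappa> y \<in> V" if "y \<in> W" for y
    using that coord_param(1)[OF \<kappa>] by (auto simp: W_def)
  have nz: "mink (f y) vinf \<noteq> 0" and eq: "(\<sigma>inf \<circ> param \<kappa>) y = (- inverse (mink (f y) vinf)) *\<^sub>R f y"
    if "y \<in> W" for y
    using sigma_inf_scale[OF _ V(4) V(5)] par[OF that] V(2) by (auto simp: f_def)
  have "smooth_on W (\<lambda>y. - inverse (mink (f y) vinf))"
    by (rule smooth_on_linear[OF W(1) bounded_linear_minus[OF bounded_linear_ident]
          smooth_on_inverse[OF W(1) nz smooth_on_bilinear[OF W(1) bounded_bilinear_mink_real W(2) smooth_on_const]]])
  then have "smooth_on W (\<lambda>y. (- inverse (mink (f y) vinf)) *\<^sub>R f y)"
    by (rule smooth_on_bilinear[OF W(1) bounded_bilinear_scaleR _ W(2)])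
  then have "smooth_on W (\<sigma>inf \<circ> param \<kappa>)" by (rule smooth_on_congI[OF W(1)]) (rule eq)
  with W wW show "\<exists>V. open V \<and> w \<in> V \<and> smooth_on V (\<sigma>inf \<circ> param \<kappa>)" by blast
qed

text \<open>Normalizing by \<open>vinf\<close> turns the local lifts into one lift over all of
  \<open>M\<close>, which then serves in every chart.\<close>

lemma lift_sigma_inf: "lift A \<Lambda> M \<sigma>inf"
  unfolding lift_def using open_M smooth_sectionI[OF smooth_sigma_inf] sigma_inf_props by blast

context
  fixes \<kappa> assumes \<kappa>: "\<kappa> \<in> A"
begin

lemma conformal_lift_chart: "conformal_lift (coord \<kappa> ` dom_of \<kappa>) (\<sigma>inf \<circ> param \<kappa>) (N \<circ> param \<kappa>)"
proof
  show "open (coord \<kappa> ` dom_of \<kappa>)" by (rule open_image[OF \<kappa>])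
  show "smooth_on (coord \<kappa> ` dom_of \<kappa>) (\<sigma>inf \<circ> param \<kappa>)" by (rule smooth_sigma_inf[OF \<kappa>])
  show "smooth_on (coord \<kappa> ` dom_of \<kappa>) (N \<circ> param \<kappa>)" by (rule smooth_N[OF \<kappa>])
next
  fix w X assume w: "w \<in> coord \<kappa> ` dom_of \<kappa>"
  note p = coord_param(2,3)[OF \<kappa> w] param_in_M[OF \<kappa> w]
  show "mink ((\<sigma>inf \<circ> param \<kappa>) w) ((\<sigma>inf \<circ> param \<kappa>) w) = 0"
    "mink ((N \<circ> param \<kappa>) w) ((N \<circ> param \<kappa>) w) = 1"
    using sigma_inf_props N_unit p by simp_all
  show "\<exists>\<rho>>0. \<forall>X Y. mink (ddir (\<sigma>inf \<circ> param \<kappa>) X w) (ddir (\<sigma>inf \<circ> param \<kappa>) Y w) = \<rho> * (X \<bullet> Y)"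
    using hol \<kappa> p lift_sigma_inf unfolding holomorphic_atlas_def holomorphic_chart_def metric_of_def by metis
  note n = lift_normal[OF \<kappa> chart[OF \<kappa>] p(2) p(3) lift_sigma_inf refl N_orth[OF p(3)], unfolded p(1)]
  show "mink ((\<sigma>inf \<circ> param \<kappa>) w) ((N \<circ> param \<kappa>) w) = 0"
    "mink (ddir (\<sigma>inf \<circ> param \<kappa>) X w) ((N \<circ> param \<kappa>) w) = 0"
    "mink (ddir (ddir (\<sigma>inf \<circ> param \<kappa>) 1) 1 w + ddir (ddir (\<sigma>inf \<circ> param \<kappa>) \<i>) \<i> w) ((N \<circ> param \<kappa>) w) = 0"
    using n(1) n(2)[of X] n(3) by simp_all
qed

text \<open>For the harder inclusion a vector is expanded in the frame of \<open>sigma_inf\<close>: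
  the first four frame vectors lie in the span, and the coefficient of \<open>N\<close> is zero for
  a vector orthogonal to \<open>N\<close>.\<close>

lemma central_sphere_chart:
  assumes p: "p \<in> dom_of \<kappa>"
  shows "central_sphere A \<Lambda> p = orth {cvec (N p)}"
proof
  have "p \<in> M" using dom_subset[OF \<kappa>] p by blast
  then show "central_sphere A \<Lambda> p \<subseteq> orth {cvec (N p)}"
    by (intro central_sphere_subset_orth chart N_orth)
  interpret conformal_lift "coord \<kappa> ` dom_of \<kappa>" "\<sigma>inf \<circ> param \<kappa>" "N \<circ> param \<kappa>"
    by (rule conformal_lift_chart)
  let ?w = "coord \<kappa> p"
  have w: "?w \<in> coord \<kappa> ` dom_of \<kappa>" "param \<kappa> ?w = p" using p coord_param(1)[OF \<kappa> p] by auto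
  note g = lift_in_central_sphere[OF \<kappa> chart[OF \<kappa>] p \<open>p \<in> M\<close> lift_sigma_inf refl]
  show "orth {cvec (N p)} \<subseteq> central_sphere A \<Lambda> p"
  proof
    fix v assume v: "v \<in> orth {cvec (N p)}"
    obtain a b c d e where e: "v = a *s cvec ((\<sigma>inf \<circ> param \<kappa>) ?w) + b *s cvec (ddir (\<sigma>inf \<circ> param \<kappa>) 1 ?w)
      + c *s cvec (ddir (\<sigma>inf \<circ> param \<kappa>) \<i> ?w) + d *s cvec (lap (\<sigma>inf \<circ> param \<kappa>) ?w) + e *s cvec ((N \<circ> param \<kappa>) ?w)"
      using frame_expand_complex[OF w(1)] .
    let ?g = "a *s cvec ((\<sigma>inf \<circ> param \<kappa>) ?w) + b *s cvec (ddir (\<sigma>inf \<circ> param \<kappa>) 1 ?w)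
      + c *s cvec (ddir (\<sigma>inf \<circ> param \<kappa>) \<i> ?w) + d *s cvec (lap (\<sigma>inf \<circ> param \<kappa>) ?w)"
    have g: "?g \<in> central_sphere A \<Lambda> p"
      using g w(2) unfolding central_sphere_def by (intro vec.span_add vec.span_scale) simp_all
    then have "mink ?g (cvec (N p)) = 0"
      using \<open>central_sphere A \<Lambda> p \<subseteq> orth {cvec (N p)}\<close> mem_orth_singleton by blast
    moreover have v': "v = ?g + e *s cvec (N p)" using e w(2) by simp
    moreover have "mink v (cvec (N p)) = 0" using v by (simp add: mem_orth_singleton)
    ultimately have "e = 0"
      using N_unit[OF \<open>p \<in> M\<close>] by (simp only: mink_add_left[of ?g] mink_scale_left mink_cvec) simp
    with g v' show "v \<in> central_sphere A \<Lambda> p" by simp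
  qed
qed

end

lemma central_sphere_eq: "p \<in> M \<Longrightarrow> central_sphere A \<Lambda> p = orth {cvec (N p)}"
  using M_cover central_sphere_chart by blast

lemma real_central_sphere_eq: "p \<in> M \<Longrightarrow> real_central_sphere A \<Lambda> p = orth {N p}"
  by (auto simp: real_central_sphere_def central_sphere_eq mem_orth_singleton mink_cvec)

text \<open>The projection onto the normal line is \<open>(vinf, N) N\<close>, to be compared with
  \<open>h N\<close>; the comparison is valid for \<open>h = 0\<close> too.\<close>

lemma vinf_N: "p \<in> M \<Longrightarrow> mink (N p) vinf = h"
proof -
  assume p: "p \<in> M"
  have "h *\<^sub>R N p = mink vinf (N p) *s N p"
    using v_perp_N[OF p] N_unit[OF p] by (simp add: v_perp_def real_central_sphere_eq[OF p] proj_orth_orth_unit)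
  then have "mink (h *\<^sub>R N p) (N p) = mink (mink vinf (N p) *s N p) (N p)" by simp
  then show ?thesis using N_unit[OF p] by (simp add: mink_scaleR_left mink_scale_left mink_commute[of "N p" vinf])
qed

lemma v_tan_N: "p \<in> M \<Longrightarrow> v_tan A \<Lambda> vinf p = vinf - h *\<^sub>R N p"
  using vinf_N[of p] mink_commute[of vinf "N p"]
  by (simp add: v_tan_def real_central_sphere_eq proj_orth_unit N_unit scalar_mult_eq_scaleR)

lemma cmc_chart:
  assumes \<kappa>: "\<kappa> \<in> A"
  shows "cmc_chart (coord \<kappa> ` dom_of \<kappa>) (\<sigma>inf \<circ> param \<kappa>) (N \<circ> param \<kappa>) vinf h
    (central_sphere A \<Lambda> \<circ> param \<kappa>) (q_inf A \<Lambda> vinf N \<kappa>)"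
proof (intro cmc_chart.intro cmc_lift.intro conformal_lift_chart[OF \<kappa>], unfold_locales)
  fix w assume w: "w \<in> coord \<kappa> ` dom_of \<kappa>"
  note p = param_in_M[OF \<kappa> w]
  show "mink ((\<sigma>inf \<circ> param \<kappa>) w) vinf = - 1" "mink ((N \<circ> param \<kappa>) w) vinf = h"
    "(central_sphere A \<Lambda> \<circ> param \<kappa>) w = orth {cvec ((N \<circ> param \<kappa>) w)}"
    using p by (simp_all add: sigma_inf_props vinf_N central_sphere_eq)
  show "q_inf A \<Lambda> vinf N \<kappa> w X v =
      complex_of_real h *s ((1/2) *s wedge (cvec ((\<sigma>inf \<circ> param \<kappa>) w)) (cvec (ddir (N \<circ> param \<kappa>) X w)) v)" for X v
    by (simp add: q_inf_def eta_inf_def mc[OF p])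
qed

lemma endo_one_form_q: "endo_one_form A (q_inf A \<Lambda> vinf N)"
  unfolding endo_one_form_def
proof (intro conjI ballI allI)
  fix \<kappa> X v assume \<kappa>: "\<kappa> \<in> A"
  interpret cmc_chart "coord \<kappa> ` dom_of \<kappa>" "\<sigma>inf \<circ> param \<kappa>" "N \<circ> param \<kappa>" vinf h
    "central_sphere A \<Lambda> \<circ> param \<kappa>" "q_inf A \<Lambda> vinf N \<kappa>" by (rule cmc_chart[OF \<kappa>])
  let ?U = "coord \<kappa> ` dom_of \<kappa>"
  let ?s = "\<lambda>w. cvec ((\<sigma>inf \<circ> param \<kappa>) w)" and ?b = "\<lambda>w. cvec ((h / 2) *\<^sub>R ddir (N \<circ> param \<kappa>) X w)"
  have s: "smooth_on ?U ?s" by (rule smooth_on_linear[OF open_U bounded_linear_cvec smooth_s])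
  have b: "smooth_on ?U ?b"
    by (rule smooth_on_linear[OF open_U bounded_linear_cvec
          smooth_on_linear[OF open_U bounded_linear_scaleR_right smooth_dn]])
  note bl = smooth_on_bilinear[OF open_U bounded_bilinear_scale
      smooth_on_bilinear[OF open_U bounded_bilinear_mink_complex smooth_on_const]]
  have "smooth_on ?U (\<lambda>w. mink v (?s w) *s ?b w - mink v (?b w) *s ?s w)"
    by (rule smooth_on_diff[OF open_U bl[OF s b] bl[OF b s]])
  then show "smooth_on ?U (\<lambda>w. q_inf A \<Lambda> vinf N \<kappa> w X v)"
    by (rule smooth_on_congI[OF open_U]) (simp add: q_wedge wedge_def)
next
  fix \<kappa> w v assume \<kappa>: "\<kappa> \<in> A" and w: "w \<in> coord \<kappa> ` dom_of \<kappa>"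
  interpret cmc_chart "coord \<kappa> ` dom_of \<kappa>" "\<sigma>inf \<circ> param \<kappa>" "N \<circ> param \<kappa>" vinf h
    "central_sphere A \<Lambda> \<circ> param \<kappa>" "q_inf A \<Lambda> vinf N \<kappa>" by (rule cmc_chart[OF \<kappa>])
  show "linear (\<lambda>X. q_inf A \<Lambda> vinf N \<kappa> w X v)"
    unfolding q_eq[OF w]
    by (rule linearI)
       (simp_all add: linear_add[OF linear_ddir[OF diff_n[OF w]]] linear_scale[OF linear_ddir[OF diff_n[OF w]]]
          cvec_linear wedge_linear scaleR_eq_of_real_scale vec_eq_iff algebra_simps)
next
  fix \<kappa> \<kappa>' p X assume \<kappa>: "\<kappa> \<in> A" "\<kappa>' \<in> A" and p: "p \<in> dom_of \<kappa> \<inter> dom_of \<kappa>'"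
  define W where "W = coord \<kappa> ` (dom_of \<kappa> \<inter> dom_of \<kappa>')"
  define \<tau> where "\<tau> = coord \<kappa>' \<circ> param \<kappa>"
  have W: "open W" "coord \<kappa> p \<in> W"
    using chart_open_image[OF chart[OF \<kappa>(1)] open_dom[OF \<kappa>(2)]] p by (auto simp: W_def)
  have par: "param \<kappa> (coord \<kappa> p) = p" "param \<kappa>' (coord \<kappa>' p) = p"
    using coord_param(1) \<kappa> p by auto
  have \<tau>: "smooth_on W \<tau>"
    using surface \<kappa> by (auto simp: oriented_surface_def oriented_transition_def Let_def W_def \<tau>_def)
  have d\<tau>: "\<tau> differentiable (at (coord \<kappa> p))" by (rule smooth_on_differentiable[OF \<tau> W(2)])
  have \<tau>p: "\<tau> (coord \<kappa> p) = coord \<kappa>' p" by (simp add: \<tau>_def par)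
  have dN: "(N \<circ> param \<kappa>') differentiable (at (coord \<kappa>' p))"
    by (rule smooth_on_differentiable[OF smooth_N[OF \<kappa>(2)]]) (use p in auto)
  \<comment> \<open>Compatibility of the chart expressions is the chain rule for \<open>N\<close>,
    whose expressions in the two charts differ by the transition map near the point.\<close>
  have "ddir (N \<circ> param \<kappa>) X (coord \<kappa> p) = ddir (\<lambda>y. (N \<circ> param \<kappa>') (\<tau> y)) X (coord \<kappa> p)"
    by (rule ddir_cong_open[OF W]) (use coord_param(1)[OF \<kappa>(1)] coord_param(1)[OF \<kappa>(2)] in \<open>auto simp: W_def \<tau>_def\<close>)
  also have "\<dots> = ddir (N \<circ> param \<kappa>') (ddir \<tau> X (coord \<kappa> p)) (coord \<kappa>' p)"
    by (rule ddir_eq, rule has_derivative_compose[OF has_derivative_ddir[OF d\<tau>]], unfold \<tau>p,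
        rule has_derivative_ddir[OF dN])
  finally show "q_inf A \<Lambda> vinf N \<kappa> (coord \<kappa> p) X =
      q_inf A \<Lambda> vinf N \<kappa>' (coord \<kappa>' p) (ddir (coord \<kappa>' \<circ> param \<kappa>) X (coord \<kappa> p))"
    by (simp add: q_inf_def eta_inf_def par \<tau>_def fun_eq_iff)
qed

lemma real_form_q: "real_form_in A (wedge_bundle A \<Lambda>) (q_inf A \<Lambda> vinf N)"
  unfolding real_form_in_def
proof (intro conjI ballI allI endo_one_form_q)
  fix \<kappa> p X assume \<kappa>: "\<kappa> \<in> A" and p: "p \<in> dom_of \<kappa>"
  interpret cmc_chart "coord \<kappa> ` dom_of \<kappa>" "\<sigma>inf \<circ> param \<kappa>" "N \<circ> param \<kappa>" vinf h
    "central_sphere A \<Lambda> \<circ> param \<kappa>" "q_inf A \<Lambda> vinf N \<kappa>" by (rule cmc_chart[OF \<kappa>])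
  let ?w = "coord \<kappa> p"
  have w: "?w \<in> coord \<kappa> ` dom_of \<kappa>" "param \<kappa> ?w = p" using p coord_param(1)[OF \<kappa> p] by auto
  have pM: "p \<in> M" using dom_subset[OF \<kappa>] p by blast
  have q: "q_inf A \<Lambda> vinf N \<kappa> ?w X = wedge (cvec (\<sigma>inf p)) (cvec ((h / 2) *\<^sub>R ddir (N \<circ> param \<kappa>) X ?w))"
    using q_wedge[OF w(1)] w(2) by (simp add: fun_eq_iff)
  note l = lift_in_Lambda1[OF \<kappa> chart[OF \<kappa>] p pM lift_sigma_inf refl]
  obtain a b c where v: "ddir (N \<circ> param \<kappa>) X ?w = a *\<^sub>R (\<sigma>inf \<circ> param \<kappa>) ?w + b *\<^sub>R ddir (\<sigma>inf \<circ> param \<kappa>) 1 ?w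
      + c *\<^sub>R ddir (\<sigma>inf \<circ> param \<kappa>) \<i> ?w" using dn_tangent[OF w(1)] .
  \<comment> \<open>\<open>dn_tangent\<close> excludes the Laplacian direction, so the second factor
    stays in \<open>Lambda1\<close>.\<close>
  have "cvec ((h / 2) *\<^sub>R ddir (N \<circ> param \<kappa>) X ?w) \<in> Lambda1 A \<Lambda> p"
    unfolding v cvec_add cvec_scaleR using l w(2) unfolding Lambda1_def
    by (intro vec.span_scale vec.span_add) simp_all
  then show "q_inf A \<Lambda> vinf N \<kappa> ?w X \<in> wedge_bundle A \<Lambda> p"
    using sigma_inf_props(1)[OF pM] unfolding q wedge_bundle_def by blast
  show "q_inf A \<Lambda> vinf N \<kappa> ?w X (cnj_vec v) = cnj_vec (q_inf A \<Lambda> vinf N \<kappa> ?w X v)" for v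
    unfolding q wedge_def cnj_vec_diff cnj_vec_scale mink_cnj_vec[symmetric] cnj_vec_cvec ..
qed

lemma constrained_Willmore_q: "constrained_Willmore A \<Lambda> (q_inf A \<Lambda> vinf N)"
  unfolding constrained_Willmore_def
proof (intro conjI ballI allI real_form_q)
  fix \<kappa> w X Y v assume \<kappa>: "\<kappa> \<in> A" and w: "w \<in> coord \<kappa> ` dom_of \<kappa>"
  interpret cmc_chart "coord \<kappa> ` dom_of \<kappa>" "\<sigma>inf \<circ> param \<kappa>" "N \<circ> param \<kappa>" vinf h
    "central_sphere A \<Lambda> \<circ> param \<kappa>" "q_inf A \<Lambda> vinf N \<kappa>" by (rule cmc_chart[OF \<kappa>])
  show "let S = central_sphere A \<Lambda> \<circ> param \<kappa>
      in ext_D S (q_inf A \<Lambda> vinf N \<kappa>) w X Y v = 0 \<and>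
         ext_D S (star (form_N S)) w X Y v =
           2 *s wedge_bracket (q_inf A \<Lambda> vinf N \<kappa>) (star (form_N S)) w X Y v"
    using ext_D_q[OF w] ext_D_star_N[OF w] by (simp add: Let_def)
qed

lemma p_inf_eq:
  assumes "x \<in> M"
  shows "p_inf A \<Lambda> vinf \<zeta> x =
    cvec vinf + (complex_of_real h * ((inverse \<zeta> + \<zeta>) / 2 - 1)) *s cvec (N x)"
  by (simp add: p_inf_def v_perp_N[OF assms] v_tan_N[OF assms] cvec_linear)
     (simp add: vec_eq_iff field_simps)

lemma conserved_quantity_p_inf:
  assumes "vinf \<noteq> 0"
  shows "conserved_quantity M A \<Lambda> (q_inf A \<Lambda> vinf N) (p_inf A \<Lambda> vinf)"
  unfolding conserved_quantity_def
proof (intro conjI exI[of _ "v_tan A \<Lambda> vinf"] exI[of _ "\<lambda>x. (1/2) *s cvec (v_perp A \<Lambda> vinf x)"]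
    constrained_Willmore_q ballI allI impI)
  \<comment> \<open>The projection is defined pointwise by a description operator; its smoothness is
    read off from \<open>vinf - h N\<close>, with \<open>h\<close> constant.\<close>
  show "smooth_section A M (v_tan A \<Lambda> vinf)"
  proof (rule smooth_sectionI)
    fix \<kappa> assume \<kappa>: "\<kappa> \<in> A"
    have "smooth_on (coord \<kappa> ` dom_of \<kappa>) (\<lambda>w. vinf - h *\<^sub>R (N \<circ> param \<kappa>) w)"
      by (rule smooth_on_diff[OF open_image[OF \<kappa>] smooth_on_const
            smooth_on_linear[OF open_image[OF \<kappa>] bounded_linear_scaleR_right smooth_N[OF \<kappa>]]])
    then show "smooth_on (coord \<kappa> ` dom_of \<kappa>) (v_tan A \<Lambda> vinf \<circ> param \<kappa>)"
      by (rule smooth_on_congI[OF open_image[OF \<kappa>]]) (simp add: v_tan_N param_in_M[OF \<kappa>])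
  qed
  show "smooth_section A M (\<lambda>x. (1/2) *s cvec (v_perp A \<Lambda> vinf x))"
  proof (rule smooth_sectionI)
    fix \<kappa> assume \<kappa>: "\<kappa> \<in> A"
    note op = open_image[OF \<kappa>]
    have "smooth_on (coord \<kappa> ` dom_of \<kappa>) (\<lambda>w. (1/2) *s cvec (h *\<^sub>R (N \<circ> param \<kappa>) w))"
      by (rule smooth_on_bilinear[OF op bounded_bilinear_scale smooth_on_const
            smooth_on_linear[OF op bounded_linear_cvec smooth_on_linear[OF op bounded_linear_scaleR_right smooth_N[OF \<kappa>]]]])
    then show "smooth_on (coord \<kappa> ` dom_of \<kappa>) ((\<lambda>x. (1/2) *s cvec (v_perp A \<Lambda> vinf x)) \<circ> param \<kappa>)"
      by (rule smooth_on_congI[OF op]) (simp add: v_perp_N param_in_M[OF \<kappa>])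
  qed
next
  fix x assume x: "x \<in> M"
  show "v_tan A \<Lambda> vinf x \<in> real_central_sphere A \<Lambda> x"
    using vinf_N[OF x] N_unit[OF x] mink_commute[of vinf "N x"]
    by (simp add: real_central_sphere_eq[OF x] v_tan_N[OF x] mem_orth_singleton mink_linear mink_scaleR_left)
  show "(1/2) *s cvec (v_perp A \<Lambda> vinf x) \<in> orth (central_sphere A \<Lambda> x)"
    using N_unit[OF x]
    by (simp add: central_sphere_eq[OF x] mem_orth_orth_unit mink_cvec v_perp_N[OF x] mink_linear mink_scaleR_left cvec_linear)
  show "p_inf A \<Lambda> vinf \<zeta> x = inverse \<zeta> *s ((1/2) *s cvec (v_perp A \<Lambda> vinf x)) + cvec (v_tan A \<Lambda> vinf x)
      + \<zeta> *s cnj_vec ((1/2) *s cvec (v_perp A \<Lambda> vinf x))" for \<zeta>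
    by (simp add: p_inf_def cnj_vec_scale cnj_vec_cvec)
  \<comment> \<open>At spectral parameter \<open>1\<close> the coefficient of \<open>N\<close>
    vanishes, leaving the constant \<open>vinf\<close>.\<close>
  have "cvec vinf \<noteq> 0" using assms cvec_eq_iff[of vinf 0] by (simp add: cvec_zero)
  then show "p_inf A \<Lambda> vinf 1 x \<noteq> 0" by (simp add: p_inf_eq[OF x])
next
  fix \<zeta> :: complex and \<kappa> w X
  assume \<zeta>: "\<zeta> \<noteq> 0" and \<kappa>: "\<kappa> \<in> A" and w: "w \<in> coord \<kappa> ` dom_of \<kappa>"
  interpret cmc_chart "coord \<kappa> ` dom_of \<kappa>" "\<sigma>inf \<circ> param \<kappa>" "N \<circ> param \<kappa>" vinf h
    "central_sphere A \<Lambda> \<circ> param \<kappa>" "q_inf A \<Lambda> vinf N \<kappa>" by (rule cmc_chart[OF \<kappa>])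
  show "conn_zeta (central_sphere A \<Lambda> \<circ> param \<kappa>) (q_inf A \<Lambda> vinf N \<kappa>) \<zeta> X (p_inf A \<Lambda> vinf \<zeta> \<circ> param \<kappa>) w = 0"
    by (rule conn_zeta_p[OF w \<zeta>]) (simp add: p_inf_eq param_in_M[OF \<kappa>])
qed

end

theorem proposition8p20:
  fixes M :: "('m::{t2_space, second_countable_topology}) set"
    and A :: "'m chart set"
    and \<Lambda> :: "'m \<Rightarrow> (real ^ 5) set"
    and vinf :: "real ^ 5"
    and N :: "'m \<Rightarrow> real ^ 5"
  assumes "oriented_surface M A"
    and "conformal_surface M A \<Lambda>"
    and "holomorphic_atlas A \<Lambda>"
    and "vinf \<noteq> 0"
    and "constant_mean_curvature M A \<Lambda> vinf"
    and "unit_normal M A \<Lambda> vinf N"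
  shows "conserved_quantity M A \<Lambda> (q_inf A \<Lambda> vinf N) (p_inf A \<Lambda> vinf)"
proof -
  obtain h where "surface_in_space_form M \<Lambda> vinf" "\<And>p. p \<in> M \<Longrightarrow> mean_curvature A \<Lambda> vinf p = h"
    using assms(5) by (auto simp: constant_mean_curvature_def constant_on_def)
  then interpret cmc_surface M A \<Lambda> vinf N h
    using assms by unfold_locales
  show ?thesis by (rule conserved_quantity_p_inf[OF assms(4)])
qed

end
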